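(* Let $\Lambda$ be a countable set of distinct real numbers, let $f(s)\in\mathcal{D}_{\Lambda}$ be an almost periodic function in an open vertical strip $U$, and let $\sigma_0=\operatorname{Re}s_0$ with $s_0\in U$. Then: i) If $f_1\overset{*}{\sim}f$, then $\operatorname{Img}\left(f_1(\sigma_0+it)\right)\subset\overline{\operatorname{Img}\left(f(\sigma_0+it)\right)}$ and $\overline{\operatorname{Img}\left(f(\sigma_0+it)\right)}=\overline{\operatorname{Img}\left(f_1(\sigma_0+it)\right)}$. ii) $\operatorname{Img}\left(F_f(\sigma_0,\mathbf{x},\mathbf{p}_1,\mathbf{p}_2,\ldots)\right)=\bigcup_{f_k\overset{*}{\sim}f}\operatorname{Img}\left(f_k(\sigma_0+it)\right)$. iii) $\operatorname{Img}\left(F_f(\sigma_0,\mathbf{x},\mathbf{p}_1,\mathbf{p}_2,\ldots)\right)$ is a closed set. iv) $\operatorname{Img}\left(F_f(\sigma_0,\mathbf{x},\mathbf{p}_1,\mathbf{p}_2,\ldots)\right)=\overline{\operatorname{Img}\left(f_1(\sigma_0+it)\right)}$ for any $f_1\overset{*}{\sim}f$.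
   Context: Almost periodic functions. For an open vertical strip $U=\{s\in\mathbb{C}:\alpha<\operatorname{Re}s<\beta\}$ with $-\infty\le\alpha<\beta\le\infty$, $AP(U,\mathbb{C})$ is the set of functions $f:U\to\mathbb{C}$ that can be approximated uniformly on every reduced strip $\{s:\alpha_1\le\operatorname{Re}s\le\beta_1\}$, $\alpha<\alpha_1<\beta_1<\beta$, by exponential polynomials $c_1e^{\mu_1s}+\cdots+c_ne^{\mu_ns}$ with $c_j\in\mathbb{C}$, $\mu_j\in\mathbb{R}$. The Dirichlet series of $f\in AP(U,\mathbb{C})$ is the formal series $\sum_{\lambda}a(\lambda)e^{\lambda s}$, where $a(\lambda)=\lim_{T\to\infty}\frac{1}{2T}\int_{-T}^{T}f(\sigma+it)e^{-\lambda(\sigma+it)}\,dt$ (independent of $\sigma\in(\alpha,\beta)$), nonzero for at most countably many real $\lambda$; it determines $f$. The class $\mathcal{D}_\Lambda$. For a countable set $\Lambda=\{\lambda_1,\lambda_2,\ldots\}$ of distinct real numbers, $f\in\mathcal{D}_\Lambda$ means that $f\in AP(U,\mathbb{C})$ for an open vertical strip $U$ and that its Dirichlet series is of the form $\sum_{j\ge1}a_je^{\lambda_js}$, $a_j\in\mathbb{C}$. Bochner-Fejér summation. For $f\in AP(U,\mathbb{C})$ with Dirichlet series $\sum_{j\ge1} a_je^{\lambda_js}$, the Bochner-Fejér polynomials are finite sums $P_k(s)=\sum_{j\ge1}p_{j,k}a_je^{\lambda_js}$, where for each $k$ only finitely many factors $p_{j,k}$ are nonzero; they converge uniformly to $f$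 on every reduced strip of $U$ and converge formally to the Dirichlet series ($p_{j,k}\to1$ as $k\to\infty$). So the Bochner-Fejér sum of the Dirichlet series of $f$ at $s\in U$ is $f(s)$. Equivalence. Let $f_1,f_2\in\mathcal{D}_\Lambda$ have Dirichlet series $\sum a_je^{\lambda_js}$ and $\sum b_je^{\lambda_js}$. Then $f_1\overset{*}{\sim}f_2$ means: for each integer $n\ge1$ with $n\le\sharp\Lambda$ there is a $\mathbb{Q}$-linear map $\psi_n:V_n\to\mathbb{R}$, where $V_n$ is the $\mathbb{Q}$-span of $\lambda_1,\ldots,\lambda_n$, with $b_j=a_je^{i\psi_n(\lambda_j)}$ for $j=1,\ldots,n$. Every function equivalent to a function of $AP(U,\mathbb{C})$ is also in $AP(U,\mathbb{C})$. Natural basis. $G_\Lambda^*=\{g_1,g_2,\ldots\}$ is the basis of the $\mathbb{Q}$-span of $\Lambda$ obtained greedily: going through $\lambda_1,\lambda_2,\ldots$ in order, $\lambda_j$ is kept iff it is $\mathbb{Q}$-linearly independent of the elements already kept. For each $j$, $\mathbf{r}_j=(r_{j,1},r_{j,2},\ldots)$ is the finitely supported vector of rationals with $\lambda_j=\langle\mathbf{r}_j,\mathbf{g}\rangle=\sum_kr_{j,k}g_k$, $\mathbf{g}=(g_1,g_2,\ldots)$; in general $\langle\mathbf{r}_j,\mathbf{x}\rangle=\sum_kr_{j,k}x_k$. Auxiliary function. If $f\in\mathcal{D}_\Lambda$ is almost periodic in $\{\alpha<\operatorname{Re}s<\beta\}$ with Dirichlet series $\sum_{j\ge1}a_je^{\lambda_js}$,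 then for $\sigma\in(\alpha,\beta)$, $\mathbf{x}\in[0,2\pi)^{\sharp G_\Lambda^*}$ and $\mathbf{p}_j\in2\pi\mathbb{Z}^{\sharp G_\Lambda^*}$ ($j\ge1$), $$F_f(\sigma,\mathbf{x},\mathbf{p}_1,\mathbf{p}_2,\ldots)=\sum_{j\ge1}a_je^{\lambda_j\sigma}e^{i\langle\mathbf{r}_j,\mathbf{x}+\mathbf{p}_j\rangle},$$ summed by the Bochner-Fejér procedure applied at $t=0$ to $\sum_{j\ge1}a_je^{i\langle\mathbf{r}_j,\mathbf{x}+\mathbf{p}_j\rangle}e^{\lambda_js}$, $s=\sigma+it$. Notation. $\operatorname{Img}(F_f(\sigma_0,\mathbf{x},\mathbf{p}_1,\mathbf{p}_2,\ldots))$ is the set of all values $F_f(\sigma_0,\mathbf{x},\mathbf{p}_1,\mathbf{p}_2,\ldots)$ with $\mathbf{x}\in[0,2\pi)^{\sharp G_\Lambda^*}$ and $\mathbf{p}_j\in2\pi\mathbb{Z}^{\sharp G_\Lambda^*}$, $j\ge1$. $\operatorname{Img}(f(\sigma_0+it))=\{w\in\mathbb{C}:\exists t\in\mathbb{R},\ w=f(\sigma_0+it)\}$. A bar denotes closure in $\mathbb{C}$. The union in ii) is over all $f_k\in\mathcal{D}_\Lambda$ almost periodic in $U$ with $f_k\overset{*}{\sim}f$.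
   Formalization: Img(F_f) is taken only over families p_1, p_2, … for which, for each n, a single q in 2πZ^#G satisfies ⟨r_j,p_j⟩ ≡ ⟨r_j,q⟩ mod 2π for all j ≤ n; for arbitrary p_j parts ii) and iv) fail, e.g. for e^s+e^{s/2}+e^{3s/2}. *)

theory Defs
  imports "HOL-Analysis.Analysis"
begin

definition vstrip :: "ereal \<Rightarrow> ereal \<Rightarrow> complex set" where
  "vstrip \<alpha> \<beta> = {s. \<alpha> < ereal (Re s) \<and> ereal (Re s) < \<beta>}"

definition closed_vstrip :: "real \<Rightarrow> real \<Rightarrow> complex set" where
  "closed_vstrip \<alpha>1 \<beta>1 = {s. \<alpha>1 \<le> Re s \<and> Re s \<le> \<beta>1}"

definition exp_poly :: "(complex \<Rightarrow> complex) \<Rightarrow> bool" where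
  "exp_poly P \<longleftrightarrow> (\<exists>(M :: real set) (c :: real \<Rightarrow> complex). finite M \<and>
     P = (\<lambda>s. \<Sum>\<mu>\<in>M. c \<mu> * exp (of_real \<mu> * s)))"

text \<open>A function on the strip is represented by a total function whose values outside the strip
  are irrelevant.\<close>

definition AP :: "ereal \<Rightarrow> ereal \<Rightarrow> (complex \<Rightarrow> complex) set" where
  "AP \<alpha> \<beta> = {f. \<forall>\<alpha>1 \<beta>1. \<alpha> < ereal \<alpha>1 \<longrightarrow> \<alpha>1 < \<beta>1 \<longrightarrow> ereal \<beta>1 < \<beta> \<longrightarrow>
     (\<forall>\<epsilon>>0. \<exists>P. exp_poly P \<and> (\<forall>s\<in>closed_vstrip \<alpha>1 \<beta>1. cmod (f s - P s) < \<epsilon>))}"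

text \<open>The mean value does not depend on the abscissa \<open>\<sigma>\<close> when \<open>f\<close> is almost periodic in the strip,
  so that the description is then uniquely satisfied.\<close>

definition dirichlet_coeff ::
    "ereal \<Rightarrow> ereal \<Rightarrow> (complex \<Rightarrow> complex) \<Rightarrow> real \<Rightarrow> complex" where
  "dirichlet_coeff \<alpha> \<beta> f \<mu> = (THE a. \<forall>\<sigma>. \<alpha> < ereal \<sigma> \<and> ereal \<sigma> < \<beta> \<longrightarrow>
     ((\<lambda>T. (1 / (2 * T)) *\<^sub>R
        integral {-T..T} (\<lambda>t. f (Complex \<sigma> t) * exp (- (of_real \<mu> * Complex \<sigma> t)))) \<longlongrightarrow> a) at_top)"

definition DirichletAP :: "ereal \<Rightarrow> ereal \<Rightarrow> real set \<Rightarrow> (complex \<Rightarrow> complex) set" where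
  "DirichletAP \<alpha> \<beta> \<Lambda> = {f \<in> AP \<alpha> \<beta>. \<forall>\<mu>. \<mu> \<notin> \<Lambda> \<longrightarrow> dirichlet_coeff \<alpha> \<beta> f \<mu> = 0}"

definition rat_scale :: "rat \<Rightarrow> real \<Rightarrow> real" where
  "rat_scale q x = of_rat q * x"

interpretation rat_vs: vector_space rat_scale
  by unfold_locales (simp_all add: rat_scale_def algebra_simps of_rat_add of_rat_mult)

definition rat_linear_on :: "real set \<Rightarrow> (real \<Rightarrow> real) \<Rightarrow> bool" where
  "rat_linear_on V \<psi> \<longleftrightarrow>
     (\<forall>x\<in>V. \<forall>y\<in>V. \<psi> (x + y) = \<psi> x + \<psi> y) \<and> (\<forall>q. \<forall>x\<in>V. \<psi> (rat_scale q x) = rat_scale q (\<psi> x))"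

text \<open>A countable set \<open>\<Lambda>\<close> is enumerated without repetition by \<open>lam\<close> on the index set \<open>idx N\<close>, where
  \<open>N\<close>, possibly infinite, is the number of elements. Indices start at \<open>0\<close>, so that
  \<open>lam 0, \<dots>, lam (n - 1)\<close> are the first \<open>n\<close> elements.\<close>

definition idx :: "enat \<Rightarrow> nat set" where
  "idx N = {j. enat j < N}"

text \<open>\<open>AP_equiv \<alpha> \<beta> lam N f1 f2\<close>: here \<open>f1\<close> has coefficients \<open>a\<close>, and \<open>f2\<close> has coefficients \<open>b\<close> with
  \<open>b j = a j * exp (\<i> * \<psi> (lam j))\<close> for \<open>j < n\<close>. The map \<open>\<psi>\<close> may depend on \<open>n\<close>.\<close>

definition AP_equiv ::
    "ereal \<Rightarrow> ereal \<Rightarrow> (nat \<Rightarrow> real) \<Rightarrow> enat \<Rightarrow> (complex \<Rightarrow> complex) \<Rightarrow> (complex \<Rightarrow> complex) \<Rightarrow> bool" where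
  "AP_equiv \<alpha> \<beta> lam N f1 f2 \<longleftrightarrow>
     (\<forall>n\<ge>1. enat n \<le> N \<longrightarrow> (\<exists>\<psi>. rat_linear_on (rat_vs.span (lam ` {..<n})) \<psi> \<and>
        (\<forall>j<n. dirichlet_coeff \<alpha> \<beta> f2 (lam j) =
               dirichlet_coeff \<alpha> \<beta> f1 (lam j) * exp (\<i> * of_real (\<psi> (lam j))))))"

primrec kept :: "(nat \<Rightarrow> real) \<Rightarrow> nat \<Rightarrow> real set" where
  "kept lam 0 = {}"
| "kept lam (Suc j) =
     (if rat_vs.independent (insert (lam j) (kept lam j)) then insert (lam j) (kept lam j)
      else kept lam j)"

definition natural_basis :: "(nat \<Rightarrow> real) \<Rightarrow> enat \<Rightarrow> real set" where
  "natural_basis lam N = (\<Union>n\<in>{n. enat n \<le> N}. kept lam n)"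

text \<open>Vectors with one coordinate for each basis element are functions on the basis itself: the
  coordinate \<open>x\<^sub>k\<close> belonging to \<open>g\<^sub>k\<close> is \<open>x g\<^sub>k\<close>. The coordinate vector \<open>r\<^sub>j\<close> of \<open>lam j\<close> is given by
  \<open>rat_vs.representation\<close>.\<close>

definition pairing :: "(nat \<Rightarrow> real) \<Rightarrow> enat \<Rightarrow> nat \<Rightarrow> (real \<Rightarrow> real) \<Rightarrow> real" where
  "pairing lam N j x =
     (let r = rat_vs.representation (natural_basis lam N) (lam j)
      in \<Sum>g | r g \<noteq> 0. of_rat (r g) * x g)"

definition torus_box :: "real set \<Rightarrow> (real \<Rightarrow> real) set" where
  "torus_box G = {x. \<forall>g\<in>G. 0 \<le> x g \<and> x g < 2 * pi}"

definition period_lattice :: "real set \<Rightarrow> (real \<Rightarrow> real) set" where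
  "period_lattice G = {p. \<forall>g\<in>G. \<exists>m::int. p g = 2 * pi * of_int m}"

text \<open>The formal series with exponents \<open>lam j\<close> and coefficients \<open>c j\<close> has the Bochner-Fejer sum \<open>w\<close> at
  \<open>s\<close>: finite partial sums with convergence factors \<open>q k j\<close> converge formally to the series, and
  uniformly on all reduced strips to a function taking the value \<open>w\<close> at \<open>s\<close>. The limit function is
  in \<open>AP \<alpha> \<beta>\<close> and has the given series as its Dirichlet series; as this determines it, the sum does
  not depend on the choice of the factors.\<close>

definition has_bochner_fejer_sum ::
    "ereal \<Rightarrow> ereal \<Rightarrow> (nat \<Rightarrow> real) \<Rightarrow> enat \<Rightarrow> (nat \<Rightarrow> complex) \<Rightarrow> complex \<Rightarrow> complex \<Rightarrow> bool" where
  "has_bochner_fejer_sum \<alpha> \<beta> lam N c s w \<longleftrightarrow>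
     (\<exists>(q :: nat \<Rightarrow> nat \<Rightarrow> real) g.
        (\<forall>k. finite {j \<in> idx N. q k j \<noteq> 0}) \<and>
        (\<forall>j\<in>idx N. (\<lambda>k. q k j) \<longlonglongrightarrow> 1) \<and>
        (\<forall>\<alpha>1 \<beta>1. \<alpha> < ereal \<alpha>1 \<longrightarrow> \<alpha>1 < \<beta>1 \<longrightarrow> ereal \<beta>1 < \<beta> \<longrightarrow>
           uniform_limit (closed_vstrip \<alpha>1 \<beta>1)
             (\<lambda>k z. \<Sum>j | j \<in> idx N \<and> q k j \<noteq> 0. of_real (q k j) * c j * exp (of_real (lam j) * z))
             g sequentially) \<and>
        g s = w)"

definition bochner_fejer_sum ::
    "ereal \<Rightarrow> ereal \<Rightarrow> (nat \<Rightarrow> real) \<Rightarrow> enat \<Rightarrow> (nat \<Rightarrow> complex) \<Rightarrow> complex \<Rightarrow> complex" where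
  "bochner_fejer_sum \<alpha> \<beta> lam N c s = (THE w. has_bochner_fejer_sum \<alpha> \<beta> lam N c s w)"

definition aux_F ::
    "ereal \<Rightarrow> ereal \<Rightarrow> (nat \<Rightarrow> real) \<Rightarrow> enat \<Rightarrow> (complex \<Rightarrow> complex) \<Rightarrow>
     real \<Rightarrow> (real \<Rightarrow> real) \<Rightarrow> (nat \<Rightarrow> real \<Rightarrow> real) \<Rightarrow> complex" where
  "aux_F \<alpha> \<beta> lam N f \<sigma> x p =
     bochner_fejer_sum \<alpha> \<beta> lam N
       (\<lambda>j. dirichlet_coeff \<alpha> \<beta> f (lam j) *
            exp (\<i> * of_real (pairing lam N j (\<lambda>g. x g + p j g))))
       (of_real \<sigma>)"

text \<open>Not every family \<open>p\<close> of vectors in the lattice is an admissible argument of \<open>aux_F\<close>. The series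
  to be summed need not be the Dirichlet series of an almost periodic function, and even if it is,
  that function need not be equivalent to \<open>f\<close>: for \<open>lam = 1, 1/2, 3/2\<close> the basis is \<open>{1}\<close>, and
  \<open>x = 0\<close>, \<open>p = 0, 0, 2 * pi\<close> turn \<open>exp s + exp (s/2) + exp (3*s/2)\<close> into
  \<open>exp s + exp (s/2) - exp (3*s/2)\<close>, which takes the value \<open>1\<close> at \<open>0\<close>, a value not in the closure of
  the range of the former on the imaginary axis. The families to be
  admitted are those whose finite parts can be replaced, modulo \<open>2 * pi\<close> in the pairings, by a
  single lattice vector. If all coordinates of all \<open>lam j\<close> are integers, this is every family.\<close>

definition coherent :: "(nat \<Rightarrow> real) \<Rightarrow> enat \<Rightarrow> (nat \<Rightarrow> real \<Rightarrow> real) \<Rightarrow> bool" where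
  "coherent lam N p \<longleftrightarrow>
     (\<forall>n\<ge>1. enat n \<le> N \<longrightarrow> (\<exists>q\<in>period_lattice (natural_basis lam N). \<forall>j<n. \<exists>m::int.
        pairing lam N j (p j) = pairing lam N j q + 2 * pi * of_int m))"

definition Img_F ::
    "ereal \<Rightarrow> ereal \<Rightarrow> (nat \<Rightarrow> real) \<Rightarrow> enat \<Rightarrow> (complex \<Rightarrow> complex) \<Rightarrow> real \<Rightarrow> complex set" where
  "Img_F \<alpha> \<beta> lam N f \<sigma> =
     {aux_F \<alpha> \<beta> lam N f \<sigma> x p | x p.
        x \<in> torus_box (natural_basis lam N) \<and>
        (\<forall>j\<in>idx N. p j \<in> period_lattice (natural_basis lam N)) \<and>
        coherent lam N p}"

definition Img_line :: "(complex \<Rightarrow> complex) \<Rightarrow> real \<Rightarrow> complex set" where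
  "Img_line f \<sigma> = {w. \<exists>t::real. w = f (Complex \<sigma> t)}"

end

theory Submission
  imports Defs
begin

text \<open>The functions equivalent to \<open>f\<close> are its twists: the coefficients \<open>a(\<nu>)\<close> are multiplied by \<open>\<xi>(\<nu>)\<close> for a
  character \<open>\<xi>\<close> of the discrete group of the reals, and vertical translates of \<open>f\<close> are the twists by
  \<open>\<nu> \<mapsto> e\<^sup>i\<^sup>\<nu>\<^sup>t\<close>. Kernels \<open>|A|\<^sup>-\<^sup>1 |\<Sum>\<^sub>a \<xi>(a) e\<^sup>-\<^sup>i\<^sup>a\<^sup>t|\<^sup>2\<close> over finite sets \<open>A\<close> of reals are nonnegative
  with mean 1, so a twist of an exponential polynomial is bounded by its supremum on the same vertical line.
  This yields Bochner-Fejer summation, the existence of all twists of \<open>f\<close>, Kronecker approximation of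
  characters by translations, and the continuous dependence of the twist at a point on \<open>\<xi>\<close>. As the
  characters form a compact group in which the translations are dense, the values at \<open>\<sigma>\<^sub>0\<close> of all
  twists are exactly the closure of the values of \<open>f\<close> on the line. The admissible arguments of the
  auxiliary function parametrize the restrictions of the characters to the exponents.\<close>

section \<open>Mean values\<close>

text \<open>Classical Bochner-Fejer kernels are products of Fejer kernels along a rational basis.
  Folner sets in the additive group of the reals avoid bases and denominators: sums of finitely many
  exponents grow polynomially, which gives nearly invariant finite sets whatever linear relations
  hold between the exponents. Since the character is built into the kernel, one estimate serves
  three ends: with the trivial character it gives the summation theorem; with a kernel close to 1 on
  the support it bounds twists; and that bound, applied to one polynomial, gives Kronecker's theorem
  for arbitrary characters. The algebraic obstacle is that a character need not be
  \<open>cis\<close> of a rational-linear map. Already on the rationals the characters form a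
  solenoid, in which those of this form are only a dense line. A linear map inducing the character
  always exists on finitely many exponents, but not in general on all of them. Hence equivalence and
  admissibility are conditions on finite initial segments, and compactness is what leads back from
  them to one character.\<close>

definition has_mean :: "(real \<Rightarrow> complex) \<Rightarrow> complex \<Rightarrow> bool" where
  "has_mean g m \<longleftrightarrow> ((\<lambda>T. (1 / (2 * T)) *\<^sub>R integral {-T..T} g) \<longlongrightarrow> m) at_top"

lemma has_mean_unique: "has_mean g m \<Longrightarrow> has_mean g m' \<Longrightarrow> m = m'"
  unfolding has_mean_def by (rule tendsto_unique[OF trivial_limit_at_top_linorder])

lemma has_mean_cong: "has_mean g m \<Longrightarrow> (\<And>t. g t = h t) \<Longrightarrow> m = m' \<Longrightarrow> has_mean h m'"
  by (simp add: ext[of g h])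

lemma has_mean_cmult: "has_mean g m \<Longrightarrow> has_mean (\<lambda>t. c * g t) (c * m)"
  unfolding has_mean_def by (drule tendsto_mult_left[of _ _ _ c]) (simp add: mult.commute)

lemma has_mean_sum:
  assumes "finite I" "\<And>i. i \<in> I \<Longrightarrow> continuous_on UNIV (g i)" "\<And>i. i \<in> I \<Longrightarrow> has_mean (g i) (m i)"
  shows "has_mean (\<lambda>t. \<Sum>i\<in>I. g i t) (\<Sum>i\<in>I. m i)"
proof -
  have "integral {-T..T} (\<lambda>t. \<Sum>i\<in>I. g i t) = (\<Sum>i\<in>I. integral {-T..T} (g i))" for T :: real
    by (intro integral_sum assms integrable_continuous_interval) (meson assms(2) continuous_on_subset subset_UNIV)
  then show ?thesis
    unfolding has_mean_def using assms(3)[unfolded has_mean_def]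
    by (auto simp: scaleR_sum_right intro!: tendsto_sum)
qed

lemma has_mean_diff:
  assumes "continuous_on UNIV g" "continuous_on UNIV h" "has_mean g m" "has_mean h m'"
  shows "has_mean (\<lambda>t. g t - h t) (m - m')"
proof -
  have "integral {-T..T} (\<lambda>t. g t - h t) = integral {-T..T} g - integral {-T..T} h" for T :: real
    by (intro integral_diff integrable_continuous_interval) (meson assms(1,2) continuous_on_subset subset_UNIV)+
  then show ?thesis
    using assms(3,4) unfolding has_mean_def by (auto simp: scaleR_diff_right intro!: tendsto_diff)
qed

lemma has_mean_const: "has_mean (\<lambda>t. c) c"
proof -
  have "eventually (\<lambda>T. (1 / (2 * T)) *\<^sub>R integral {-T..T} (\<lambda>t. c) = c) at_top"
    using eventually_gt_at_top[of 0]
    by eventually_elim (simp add: scaleR_conv_of_real)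
  then show ?thesis unfolding has_mean_def by (rule tendsto_eventually)
qed

lemma has_mean_cis: "has_mean (\<lambda>t. cis (\<nu> * t)) (if \<nu> = 0 then 1 else 0)"
proof (cases "\<nu> = 0")
  case True then show ?thesis using has_mean_const[of 1] by simp
next
  case False
  have int: "integral {-T..T} (\<lambda>t. cis (\<nu> * t)) = (cis (\<nu> * T) - cis (- (\<nu> * T))) / (\<i> * \<nu>)"
    if "T > 0" for T
  proof (rule integral_unique)
    have *: "((\<lambda>t. cis (\<nu> * t) / (\<i> * \<nu>)) has_vector_derivative cis (\<nu> * t)) (at t within {-T..T})" for t
      unfolding cis_conv_exp of_real_mult mult.assoc[symmetric]
      by (rule has_vector_derivative_real_field) (auto intro!: derivative_eq_intros simp: False)
    show "((\<lambda>t. cis (\<nu> * t)) has_integral (cis (\<nu> * T) - cis (- (\<nu> * T))) / (\<i> * \<nu>)) {-T..T}"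
      using fundamental_theorem_of_calculus[of "-T" T, OF _ *] that by (simp add: diff_divide_distrib)
  qed
  have "((\<lambda>T. (1 / (2 * T)) *\<^sub>R integral {-T..T} (\<lambda>t. cis (\<nu> * t))) \<longlongrightarrow> 0) at_top"
  proof (rule Lim_null_comparison)
    show "\<forall>\<^sub>F T in at_top. norm ((1 / (2 * T)) *\<^sub>R integral {-T..T} (\<lambda>t. cis (\<nu> * t))) \<le> (1 / \<bar>\<nu>\<bar>) * inverse T"
      using eventually_gt_at_top[of 0]
    proof eventually_elim
      case (elim T)
      have "cmod (cis (\<nu> * T) - cis (- (\<nu> * T))) \<le> 2"
        by (rule order_trans[OF norm_triangle_ineq4]) simp
      then show ?case using elim False unfolding int[OF elim]
        by (simp add: norm_divide norm_mult field_simps)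
    qed
    show "((\<lambda>T. 1 / \<bar>\<nu>\<bar> * inverse T) \<longlongrightarrow> 0) at_top"
      by (intro tendsto_mult_right_zero tendsto_inverse_0_at_top filterlim_ident)
  qed
  then show ?thesis using False by (simp add: has_mean_def)
qed

text \<open>Monotonicity of the mean, used with \<open>h\<close> a constant times a nonnegative
  kernel. The mean of the real function \<open>h\<close> is taken in the complex numbers, hence the
  \<open>Re\<close>.\<close>

lemma has_mean_bound:
  assumes cont: "continuous_on UNIV g" "continuous_on UNIV h"
    and le: "\<And>t. cmod (g t) \<le> h t"
    and mean: "has_mean g m" "has_mean (\<lambda>t. of_real (h t)) m'"
  shows "cmod m \<le> Re m'"
proof (rule tendsto_le[OF trivial_limit_at_top_linorder])
  show "((\<lambda>T. Re ((1 / (2 * T)) *\<^sub>R integral {-T..T} (\<lambda>t. of_real (h t)))) \<longlongrightarrow> Re m') at_top"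
    using mean(2) unfolding has_mean_def by (rule tendsto_Re)
  show "((\<lambda>T. cmod ((1 / (2 * T)) *\<^sub>R integral {-T..T} g)) \<longlongrightarrow> cmod m) at_top"
    using mean(1) unfolding has_mean_def by (rule tendsto_norm)
  show "\<forall>\<^sub>F T in at_top. cmod ((1 / (2 * T)) *\<^sub>R integral {-T..T} g)
      \<le> Re ((1 / (2 * T)) *\<^sub>R integral {-T..T} (\<lambda>t. of_real (h t)))"
    using eventually_gt_at_top[of 0]
  proof eventually_elim
    case (elim T)
    have c: "continuous_on {-T..T} g" "continuous_on {-T..T} h"
      using cont by (meson continuous_on_subset subset_UNIV)+
    have "integral {-T..T} (\<lambda>t. complex_of_real (h t)) = of_real (integral {-T..T} h)"
      using integral_linear[OF integrable_continuous_interval[OF c(2)] bounded_linear_of_real]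
      by (simp add: o_def)
    moreover have "cmod (integral {-T..T} g) \<le> integral {-T..T} h"
      by (intro integral_norm_bound_integral integrable_continuous_interval c le)
    ultimately show ?case using elim by (simp add: divide_right_mono)
  qed
qed

lemma has_mean_diff_bound:
  assumes "continuous_on UNIV g" "continuous_on UNIV h" "has_mean g m" "has_mean h m'"
    and "\<And>t. cmod (g t - h t) \<le> B"
  shows "cmod (m - m') \<le> B"
  using has_mean_bound[OF _ _ assms(5) has_mean_diff[OF assms(1-4)] has_mean_const]
    assms(1,2) by (simp add: continuous_on_diff)

text \<open>A uniform error is not enlarged by averaging over any interval, so the limits in
  \<open>k\<close> and in \<open>T\<close> may be interchanged.\<close>

lemma has_mean_uniform_limit:
  assumes cont: "\<And>k. continuous_on UNIV (g k)" and mean: "\<And>k. has_mean (g k) (m k)"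
    and lim: "m \<longlonglongrightarrow> l" and unif: "uniform_limit UNIV g h sequentially"
  shows "has_mean h l"
  unfolding has_mean_def
proof (rule tendstoI)
  fix e :: real assume e: "e > 0"
  have conth: "continuous_on UNIV h"
    by (rule uniform_limit_theorem[OF _ unif]) (simp_all add: cont)
  have "\<forall>\<^sub>F k in sequentially. dist (m k) l < e / 4 \<and> (\<forall>t. dist (g k t) (h t) < e / 4)"
    using e tendstoD[OF lim, of "e/4"] uniform_limitD[OF unif, of "e/4"] by (auto intro: eventually_conj)
  then obtain k where k: "dist (m k) l < e / 4" "\<And>t. dist (g k t) (h t) < e / 4"
    by (auto dest: eventually_happens)
  have "\<forall>\<^sub>F T in at_top. dist ((1 / (2 * T)) *\<^sub>R integral {-T..T} (g k)) (m k) < e / 4"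
    using mean[of k] e unfolding has_mean_def by (intro tendstoD) auto
  then show "\<forall>\<^sub>F T in at_top. dist ((1 / (2 * T)) *\<^sub>R integral {-T..T} h) l < e"
    using eventually_gt_at_top[of 0]
  proof eventually_elim
    case (elim T)
    have c: "continuous_on {-T..T} (g k)" "continuous_on {-T..T} h"
      using cont[of k] conth by (meson continuous_on_subset subset_UNIV)+
    have "integral {-T..T} h - integral {-T..T} (g k) = integral {-T..T} (\<lambda>t. h t - g k t)"
      by (intro integral_diff[symmetric] integrable_continuous_interval c)
    moreover have "cmod (integral {-T..T} (\<lambda>t. h t - g k t)) \<le> integral {-T..T} (\<lambda>t. e / 4)"
      by (intro integral_norm_bound_integral integrable_continuous_interval continuous_intros c)
        (metis dist_norm dist_commute k(2) less_imp_le)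
    ultimately have "cmod (integral {-T..T} h - integral {-T..T} (g k)) \<le> 2 * T * (e / 4)"
      using elim by simp
    then have "dist ((1 / (2 * T)) *\<^sub>R integral {-T..T} h) ((1 / (2 * T)) *\<^sub>R integral {-T..T} (g k)) \<le> e / 4"
      using elim unfolding dist_norm scaleR_diff_right[symmetric] norm_scaleR by (simp add: field_simps)
    then show ?case using elim k(1) e by metric
  qed
qed

section \<open>Exponential polynomials\<close>

text \<open>The datum is a coefficient function on all reals, on which kernels and characters act by
  pointwise multiplication. On an infinite support the sum defaults to 0, so finiteness of the
  support accompanies every use.\<close>

definition epoly :: "(real \<Rightarrow> complex) \<Rightarrow> complex \<Rightarrow> complex" where
  "epoly c s = (\<Sum>\<mu> | c \<mu> \<noteq> 0. c \<mu> * exp (of_real \<mu> * s))"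

lemma epoly_superset:
  assumes "finite M" "\<And>\<mu>. c \<mu> \<noteq> 0 \<Longrightarrow> \<mu> \<in> M"
  shows "epoly c s = (\<Sum>\<mu>\<in>M. c \<mu> * exp (of_real \<mu> * s))"
  unfolding epoly_def by (rule sum.mono_neutral_left) (use assms in auto)

lemma exp_poly_iff_epoly: "exp_poly P \<longleftrightarrow> (\<exists>c. finite {\<mu>. c \<mu> \<noteq> 0} \<and> P = epoly c)"
proof
  assume "exp_poly P"
  then obtain M c where M: "finite M" "P = (\<lambda>s. \<Sum>\<mu>\<in>M. c \<mu> * exp (of_real \<mu> * s))"
    unfolding exp_poly_def by blast
  let ?c = "\<lambda>\<mu>. if \<mu> \<in> M then c \<mu> else 0"
  have "epoly ?c s = P s" for s
    by (subst epoly_superset[of M]) (use M in \<open>auto split: if_splits\<close>)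
  moreover have "finite {\<mu>. ?c \<mu> \<noteq> 0}" by (rule finite_subset[OF _ M(1)]) auto
  ultimately show "\<exists>c. finite {\<mu>. c \<mu> \<noteq> 0} \<and> P = epoly c" by (intro exI[of _ ?c] conjI) auto
next
  assume "\<exists>c. finite {\<mu>. c \<mu> \<noteq> 0} \<and> P = epoly c"
  then show "exp_poly P" unfolding exp_poly_def epoly_def by blast
qed

lemma epoly_diff:
  assumes "finite {\<mu>. c \<mu> \<noteq> 0}" "finite {\<mu>. d \<mu> \<noteq> 0}"
  shows "epoly (\<lambda>\<mu>. c \<mu> - d \<mu>) s = epoly c s - epoly d s"
  using assms
  by (subst (1 2 3) epoly_superset[of "{\<mu>. c \<mu> \<noteq> 0} \<union> {\<mu>. d \<mu> \<noteq> 0}"])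
    (auto simp: algebra_simps sum_subtractf)

lemma finite_support_diff:
  fixes c d :: "real \<Rightarrow> complex"
  assumes "finite {\<mu>. c \<mu> \<noteq> 0}" "finite {\<mu>. d \<mu> \<noteq> 0}"
  shows "finite {\<mu>. c \<mu> - d \<mu> \<noteq> 0}"
  by (rule finite_subset[OF _ finite_UnI[OF assms]]) auto

lemma continuous_on_epoly_line: "continuous_on UNIV (\<lambda>t. epoly c (Complex \<sigma> t))"
  unfolding epoly_def Complex_eq by (intro continuous_intros)

lemma exp_vertical_shift:
  "exp (of_real \<mu> * Complex \<sigma> (t + u)) = exp (of_real \<mu> * Complex \<sigma> t) * cis (\<mu> * u)"
  by (simp add: cis_conv_exp Complex_eq exp_add[symmetric] algebra_simps)

text \<open>Orthogonality of the \<open>cis (\<mu> * t)\<close>. The factor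
  \<open>exp ((\<mu> - \<nu>) * \<sigma>)\<close> is 1 in the only surviving term, so the mean is
  the same on every vertical line.\<close>

lemma has_mean_epoly:
  assumes fin: "finite {\<mu>. c \<mu> \<noteq> 0}"
  shows "has_mean (\<lambda>t. epoly c (Complex \<sigma> t) * exp (- (of_real \<nu> * Complex \<sigma> t))) (c \<nu>)"
proof (rule has_mean_cong)
  show "has_mean (\<lambda>t. \<Sum>\<mu> | c \<mu> \<noteq> 0. (c \<mu> * exp ((\<mu> - \<nu>) * \<sigma>)) * cis ((\<mu> - \<nu>) * t))
     (\<Sum>\<mu> | c \<mu> \<noteq> 0. (c \<mu> * exp ((\<mu> - \<nu>) * \<sigma>)) * (if \<mu> - \<nu> = 0 then 1 else 0))"
    by (intro has_mean_sum fin has_mean_cmult has_mean_cis) (auto simp: cis_conv_exp intro!: continuous_intros)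
  have *: "cis (r * t) * exp (of_real (r * \<sigma>)) = exp (of_real r * Complex \<sigma> t)" for r t
    by (simp add: cis_conv_exp Complex_eq flip: exp_add) (simp add: algebra_simps)
  have "c \<mu> * exp ((\<mu> - \<nu>) * \<sigma>) * cis ((\<mu> - \<nu>) * t)
      = c \<mu> * exp (\<mu> * Complex \<sigma> t) * exp (- (of_real \<nu> * Complex \<sigma> t))" for \<mu> t
    using *[of "\<mu> - \<nu>" t] by (simp add: mult.assoc flip: exp_add exp_of_real) (simp add: algebra_simps)
  then show "(\<Sum>\<mu> | c \<mu> \<noteq> 0. (c \<mu> * exp ((\<mu> - \<nu>) * \<sigma>)) * cis ((\<mu> - \<nu>) * t))
     = epoly c (Complex \<sigma> t) * exp (- (of_real \<nu> * Complex \<sigma> t))" for t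
    unfolding epoly_def sum_distrib_right by (intro sum.cong refl)
  have "(\<Sum>\<mu> | c \<mu> \<noteq> 0. (c \<mu> * exp ((\<mu> - \<nu>) * \<sigma>)) * (if \<mu> - \<nu> = 0 then 1 else 0))
     = (\<Sum>\<mu> | c \<mu> \<noteq> 0. if \<nu> = \<mu> then c \<mu> else 0)"
    by (rule sum.cong) auto
  then show "(\<Sum>\<mu> | c \<mu> \<noteq> 0. (c \<mu> * exp ((\<mu> - \<nu>) * \<sigma>)) * (if \<mu> - \<nu> = 0 then 1 else 0)) = c \<nu>"
    by (simp add: sum.delta fin)
qed

section \<open>Characters and Folner kernels\<close>

text \<open>No continuity is required: this is the Bohr compactification of the real line.\<close>

definition real_characters :: "(real \<Rightarrow> complex) set" where
  "real_characters = {\<xi>. (\<forall>x. cmod (\<xi> x) = 1) \<and> (\<forall>x y. \<xi> (x + y) = \<xi> x * \<xi> y)}"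

lemma real_charactersD:
  assumes "\<xi> \<in> real_characters"
  shows "cmod (\<xi> x) = 1" "\<xi> (x + y) = \<xi> x * \<xi> y" "\<xi> 0 = 1" "\<xi> (- x) = cnj (\<xi> x)" "\<xi> x * cnj (\<xi> x) = 1"
    "\<xi> (x - y) = \<xi> x * cnj (\<xi> y)" "\<xi> x \<noteq> 0"
proof -
  show 1: "cmod (\<xi> x) = 1" and 2: "\<xi> (x + y) = \<xi> x * \<xi> y" for x y
    using assms by (auto simp: real_characters_def)
  show nz: "\<xi> x \<noteq> 0" for x using 1[of x] by auto
  show 0: "\<xi> 0 = 1" using 2[of 0 0] nz[of 0] by simp
  show inv: "\<xi> x * cnj (\<xi> x) = 1" for x using 1[of x] by (simp flip: complex_norm_square)
  show neg: "\<xi> (- x) = cnj (\<xi> x)" for x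
  proof -
    have "\<xi> x * \<xi> (- x) = \<xi> x * cnj (\<xi> x)" using 2[of x "-x"] 0 inv[of x] by simp
    then show ?thesis using nz[of x] by simp
  qed
  show "\<xi> (x - y) = \<xi> x * cnj (\<xi> y)" using 2[of x "-y"] neg[of y] by simp
qed

text \<open>The coefficient at frequency \<open>\<nu>\<close> of the normalised square in the
  overview, that is, the autocorrelation of \<open>A\<close>. For an arithmetic progression
  \<open>A\<close> of length \<open>m\<close> with step \<open>g\<close> it is Fejer's factor
  \<open>1 - \<bar>k\<bar> / m\<close> at \<open>k * g\<close> with
  \<open>\<bar>k\<bar> \<le> m\<close>.\<close>

definition folner_kernel :: "real set \<Rightarrow> real \<Rightarrow> real" where
  "folner_kernel A \<nu> = real (card {(a, b) \<in> A \<times> A. a - b = \<nu>}) / real (card A)"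

lemma finite_support_folner_kernel:
  assumes "finite A"
  shows "finite {\<nu>. folner_kernel A \<nu> \<noteq> 0}"
proof (rule finite_subset)
  show "finite ((\<lambda>(a, b). a - b) ` (A \<times> A))" using assms by simp
  show "{\<nu>. folner_kernel A \<nu> \<noteq> 0} \<subseteq> (\<lambda>(a, b). a - b) ` (A \<times> A)"
  proof
    fix \<nu> assume "\<nu> \<in> {\<nu>. folner_kernel A \<nu> \<noteq> 0}"
    then have "card {(a, b) \<in> A \<times> A. a - b = \<nu>} \<noteq> 0" by (auto simp: folner_kernel_def)
    then have "{(a, b) \<in> A \<times> A. a - b = \<nu>} \<noteq> {}" by (metis card.empty)
    then show "\<nu> \<in> (\<lambda>(a, b). a - b) ` (A \<times> A)" by force
  qed
qed

text \<open>The damped and twisted value is the mean over \<open>t\<close> of the polynomial at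
  height \<open>t0 + t\<close>, weighted by \<open>(cmod (D t))\<^sup>2 / card A\<close>. The
  character sits inside \<open>D\<close>, so one convolution damps and twists at once. Any nonempty
  finite \<open>A\<close> will do; invariance matters only when the damping is to be
  removed.\<close>

lemma epoly_kernel_bound:
  fixes c \<xi> :: "real \<Rightarrow> complex"
  assumes fin: "finite {\<mu>. c \<mu> \<noteq> 0}" and A: "finite A" "A \<noteq> {}" and \<xi>: "\<xi> \<in> real_characters"
    and B: "\<And>t. cmod (epoly c (Complex \<sigma> t)) \<le> B"
  shows "cmod (epoly (\<lambda>\<mu>. folner_kernel A \<mu> * \<xi> \<mu> * c \<mu>) (Complex \<sigma> t0)) \<le> B"
proof -
  define D where "D t = (\<Sum>a\<in>A. \<xi> a * cis (- (a * t)))" for t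
  define e where "e \<mu> = c \<mu> * exp (of_real \<mu> * Complex \<sigma> t0)" for \<mu>
  \<comment> \<open>Multiplicativity makes \<open>\<xi> a * cnj (\<xi> b)\<close> depend on
    \<open>a - b\<close> only, like the frequency.\<close>
  have D2: "complex_of_real ((cmod (D t))\<^sup>2) = (\<Sum>(a, b)\<in>A \<times> A. \<xi> (a - b) * cis (- (a - b) * t))" for t
    unfolding complex_norm_square D_def cnj_sum sum_product sum.cartesian_product
  proof (rule sum.cong, safe)
    fix a b
    have "cis (- (a * t)) * cis (b * t) = cis (- (a - b) * t)" by (simp add: cis_mult algebra_simps)
    then show "\<xi> a * cis (- (a * t)) * cnj (\<xi> b * cis (- (b * t))) = \<xi> (a - b) * cis (- (a - b) * t)"
      by (simp add: real_charactersD(6)[OF \<xi>] cis_cnj mult_ac)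
  qed
  have cD: "continuous_on UNIV D"
    unfolding D_def cis_conv_exp by (intro continuous_intros)
  have shift: "epoly c (Complex \<sigma> (t0 + t)) = (\<Sum>\<mu> | c \<mu> \<noteq> 0. e \<mu> * cis (\<mu> * t))" for t
    unfolding epoly_def e_def by (simp add: exp_vertical_shift mult.assoc)
  have sumcount: "(\<Sum>(a, b)\<in>A \<times> A. if a - b = \<mu> then 1 else 0) = (of_nat (card {(a, b) \<in> A \<times> A. a - b = \<mu>}) :: complex)" for \<mu>
  proof -
    have "(\<Sum>p\<in>A \<times> A. if fst p - snd p = \<mu> then 1 else 0) = (\<Sum>p\<in>{p\<in>A \<times> A. fst p - snd p = \<mu>}. 1 :: complex)"
      using A by (intro sum.inter_filter[symmetric]) simp
    moreover have "{p\<in>A \<times> A. fst p - snd p = \<mu>} = {(a, b) \<in> A \<times> A. a - b = \<mu>}" by auto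
    ultimately show ?thesis by (simp add: case_prod_unfold)
  qed
  define g where "g t = epoly c (Complex \<sigma> (t0 + t)) * of_real ((cmod (D t))\<^sup>2)" for t
  have mg: "has_mean g (card A * epoly (\<lambda>\<mu>. folner_kernel A \<mu> * \<xi> \<mu> * c \<mu>) (Complex \<sigma> t0))"
  proof (rule has_mean_cong)
    show "has_mean (\<lambda>t. \<Sum>\<mu> | c \<mu> \<noteq> 0. \<Sum>p\<in>A\<times>A. (e \<mu> * \<xi> (fst p - snd p)) * cis ((\<mu> - (fst p - snd p)) * t))
      (\<Sum>\<mu> | c \<mu> \<noteq> 0. \<Sum>p\<in>A\<times>A. (e \<mu> * \<xi> (fst p - snd p)) * (if \<mu> - (fst p - snd p) = 0 then 1 else 0))"
      unfolding cis_conv_exp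
      by (intro has_mean_sum has_mean_cmult has_mean_cis[unfolded cis_conv_exp] fin finite_cartesian_product A continuous_intros)
    show "(\<Sum>\<mu> | c \<mu> \<noteq> 0. \<Sum>p\<in>A\<times>A. (e \<mu> * \<xi> (fst p - snd p)) * cis ((\<mu> - (fst p - snd p)) * t)) = g t" for t
      unfolding g_def D2 shift sum_product case_prod_unfold
      by (intro sum.cong refl) (simp add: algebra_simps cis_mult)
    \<comment> \<open>Only the pairs with \<open>a - b = \<mu>\<close> contribute to the mean; their
      number is \<open>card A\<close> times the kernel.\<close>
    have "(\<Sum>p\<in>A\<times>A. (e \<mu> * \<xi> (fst p - snd p)) * (if \<mu> - (fst p - snd p) = 0 then 1 else 0))
        = e \<mu> * \<xi> \<mu> * (card A * of_real (folner_kernel A \<mu>))" for \<mu>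
    proof -
      have "(\<Sum>p\<in>A\<times>A. (e \<mu> * \<xi> (fst p - snd p)) * (if \<mu> - (fst p - snd p) = 0 then 1 else 0))
        = (\<Sum>p\<in>A\<times>A. e \<mu> * \<xi> \<mu> * (if fst p - snd p = \<mu> then 1 else 0))"
        by (rule sum.cong) auto
      then show ?thesis using sumcount[of \<mu>] A by (simp add: folner_kernel_def case_prod_unfold flip: sum_distrib_left)
    qed
    moreover have "epoly (\<lambda>\<mu>. folner_kernel A \<mu> * \<xi> \<mu> * c \<mu>) (Complex \<sigma> t0)
      = (\<Sum>\<mu> | c \<mu> \<noteq> 0. folner_kernel A \<mu> * \<xi> \<mu> * c \<mu> * exp (of_real \<mu> * Complex \<sigma> t0))"
      by (rule epoly_superset[OF fin]) auto
    ultimately show "(\<Sum>\<mu> | c \<mu> \<noteq> 0. \<Sum>p\<in>A\<times>A. (e \<mu> * \<xi> (fst p - snd p)) * (if \<mu> - (fst p - snd p) = 0 then 1 else 0))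
      = card A * epoly (\<lambda>\<mu>. folner_kernel A \<mu> * \<xi> \<mu> * c \<mu>) (Complex \<sigma> t0)"
      by (simp add: sum_distrib_left e_def mult_ac)
  qed
  \<comment> \<open>The diagonal pairs alone survive here, so the weight that is not normalised has
    mean \<open>card A\<close>. This factor also appears in \<open>mg\<close> and cancels at the
    end.\<close>
  have mh: "has_mean (\<lambda>t. of_real (B * (cmod (D t))\<^sup>2)) (of_real B * card A)"
  proof (rule has_mean_cong)
    show "has_mean (\<lambda>t. \<Sum>p\<in>A\<times>A. (of_real B * \<xi> (fst p - snd p)) * cis (- (fst p - snd p) * t))
      (\<Sum>p\<in>A\<times>A. (of_real B * \<xi> (fst p - snd p)) * (if - (fst p - snd p) = 0 then 1 else 0))"
      unfolding cis_conv_exp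
      by (intro has_mean_sum has_mean_cmult has_mean_cis[unfolded cis_conv_exp] fin finite_cartesian_product A continuous_intros)
    show "(\<Sum>p\<in>A\<times>A. (of_real B * \<xi> (fst p - snd p)) * cis (- (fst p - snd p) * t)) = of_real (B * (cmod (D t))\<^sup>2)" for t
      unfolding of_real_mult D2 by (simp add: sum_distrib_left case_prod_unfold mult_ac)
    have "(\<Sum>p\<in>A\<times>A. (of_real B * \<xi> (fst p - snd p)) * (if - (fst p - snd p) = 0 then 1 else 0))
        = (\<Sum>p\<in>A\<times>A. of_real B * (if fst p - snd p = 0 then 1 else 0))"
      by (rule sum.cong) (auto simp: real_charactersD(3)[OF \<xi>])
    also have "\<dots> = of_real B * card {(a, b) \<in> A \<times> A. a - b = 0}"
      using sumcount[of 0] by (simp add: case_prod_unfold flip: sum_distrib_left)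
    also have "{(a, b) \<in> A \<times> A. a - b = 0} = (\<lambda>a. (a, a)) ` A" by auto
    also have "card \<dots> = card A" by (rule card_image) (auto simp: inj_on_def)
    finally show "(\<Sum>p\<in>A\<times>A. (of_real B * \<xi> (fst p - snd p)) * (if - (fst p - snd p) = 0 then 1 else 0)) = of_real B * card A" .
  qed
  have "cmod (card A * epoly (\<lambda>\<mu>. folner_kernel A \<mu> * \<xi> \<mu> * c \<mu>) (Complex \<sigma> t0)) \<le> Re (of_real B * card A)"
  proof (rule has_mean_bound[OF _ _ _ mg mh])
    show "continuous_on UNIV g"
      unfolding g_def shift cis_conv_exp by (intro continuous_intros cD)
    show "continuous_on UNIV (\<lambda>t. B * (cmod (D t))\<^sup>2)" by (intro continuous_intros cD)
    show "cmod (g t) \<le> B * (cmod (D t))\<^sup>2" for t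
      unfolding g_def norm_mult using B[of "t0 + t"] by (simp add: mult_right_mono norm_power)
  qed
  then show ?thesis using A by (simp add: norm_mult card_gt_0_iff field_simps)
qed

section \<open>Folner sets in the additive group of the reals\<close>

lemma folner_kernel_eq:
  "folner_kernel A \<nu> = real (card (A \<inter> (\<lambda>b. \<nu> + b) ` A)) / real (card A)"
proof -
  have "{(a, b) \<in> A \<times> A. a - b = \<nu>} = (\<lambda>a. (a, a - \<nu>)) ` (A \<inter> (\<lambda>b. \<nu> + b) ` A)"
    by (force simp: image_iff)
  moreover have "inj_on (\<lambda>a. (a, a - \<nu>)) (A \<inter> (\<lambda>b. \<nu> + b) ` A)" by (auto simp: inj_on_def)
  ultimately show ?thesis by (simp add: folner_kernel_def card_image)
qed

lemma folner_kernel_le_1: "finite A \<Longrightarrow> folner_kernel A \<nu> \<le> 1"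
  unfolding folner_kernel_eq by (rule divide_le_eq_1[THEN iffD2]) (auto simp: card_gt_0_iff card_mono)

text \<open>If every step multiplied \<open>g\<close> by more than \<open>1 + \<delta>\<close>, then
  \<open>g\<close> would grow exponentially and overtake the polynomial bound.\<close>

lemma exists_slow_growth:
  fixes g :: "nat \<Rightarrow> real"
  assumes g1: "g 0 \<ge> 1" and poly: "\<And>m. g m \<le> real (Suc m) ^ d" and \<delta>: "\<delta> > 0"
  shows "\<exists>m. g (Suc m) \<le> (1 + \<delta>) * g m"
proof (rule ccontr)
  assume "\<nexists>m. g (Suc m) \<le> (1 + \<delta>) * g m"
  then have step: "(1 + \<delta>) * g m < g (Suc m)" for m by (simp add: not_le)
  have low: "(1 + \<delta>) ^ m \<le> g m" for m
  proof (induction m)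
    case (Suc m)
    have "(1 + \<delta>) ^ Suc m \<le> (1 + \<delta>) * g m" using Suc \<delta> by simp
    then show ?case using step[of m] by simp
  qed (use g1 in simp)
  \<comment> \<open>This makes \<open>(1 + \<delta>) ^ Suc m\<close> equal to
    \<open>exp (r * Suc m)\<close>, to which the limit of \<open>x ^ d / exp x\<close> applies. In
    the threshold \<open>r ^ d / (1 + \<delta>)\<close> the numerator removes the scaling by
    \<open>r\<close>, and the denominator the difference between the exponents \<open>Suc m\<close>
    and \<open>m\<close>.\<close>
  define r where "r = ln (1 + \<delta>)"
  have r: "r > 0" "exp r = 1 + \<delta>" using \<delta> by (simp_all add: r_def)
  have "filterlim (\<lambda>m. r * real (Suc m)) at_top sequentially"
    by (rule filterlim_tendsto_pos_mult_at_top[OF tendsto_const r(1)])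
      (rule filterlim_compose[OF filterlim_real_sequentially filterlim_Suc])
  from filterlim_compose[OF tendsto_power_div_exp_0[of d] this]
  have "\<forall>\<^sub>F m in sequentially. (r * real (Suc m)) ^ d / exp (r * real (Suc m)) < r ^ d / (1 + \<delta>)"
    using r \<delta> by (intro order_tendstoD(2)) auto
  then obtain m where m: "(r * real (Suc m)) ^ d / exp (r * real (Suc m)) < r ^ d / (1 + \<delta>)"
    by (auto dest: eventually_happens)
  have "exp (r * real (Suc m)) = (1 + \<delta>) * (1 + \<delta>) ^ m"
    using exp_of_nat2_mult[of r "Suc m"] r(2) by simp
  then have "r ^ d * (real (Suc m) ^ d / (1 + \<delta>) ^ m) / (1 + \<delta>) < r ^ d * 1 / (1 + \<delta>)"
    using m by (simp only: power_mult_distrib) (simp add: mult.commute)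
  then have "real (Suc m) ^ d < (1 + \<delta>) ^ m"
    using r \<delta> by (subst (asm) divide_less_cancel, subst (asm) mult_less_cancel_left) (simp add: field_simps)
  then show False using low[of m] poly[of m] by simp
qed

text \<open>The sums \<open>\<Sum>\<^sub>v n\<^sub>v v\<close> with \<open>n\<^sub>v \<le> m\<close> form a set of polynomial growth in \<open>m\<close>, so
  that for some \<open>m\<close> a step by an element of \<open>F\<close> adds few elements.\<close>

lemma exists_folner_set:
  assumes F: "finite F" and \<delta>: "\<delta> > 0"
  shows "\<exists>A. finite A \<and> A \<noteq> {} \<and> (\<forall>\<nu>\<in>F. \<bar>folner_kernel A \<nu> - 1\<bar> \<le> \<delta>)"
proof -
  define A where "A m = (\<lambda>n. \<Sum>v\<in>F. real (n v) * v) ` (PiE F (\<lambda>_. {..m}))" for m :: nat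
  have finA: "finite (A m)" and A0: "A m \<noteq> {}" for m
    using F by (auto simp: A_def PiE_eq_empty_iff intro!: finite_imageI finite_PiE)
  have "card (A m) \<le> card (PiE F (\<lambda>_. {..m}))" for m
    unfolding A_def by (intro card_image_le finite_PiE F) auto
  then have cardA: "card (A m) \<le> Suc m ^ card F" for m by (simp add: card_PiE F)
  have "real (card (A 0)) \<ge> 1" using finA[of 0] A0[of 0] by (simp add: Suc_le_eq card_gt_0_iff)
  moreover have "real (card (A m)) \<le> real (Suc m) ^ card F" for m
    using cardA[of m] by (metis of_nat_le_iff of_nat_power)
  ultimately obtain m where m: "real (card (A (Suc m))) \<le> (1 + \<delta>) * real (card (A m))"
    using exists_slow_growth[of "\<lambda>m. real (card (A m))", OF _ _ \<delta>] by blast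
  have "\<bar>folner_kernel (A m) \<nu> - 1\<bar> \<le> \<delta>" if \<nu>: "\<nu> \<in> F" for \<nu>
  proof -
    have mono: "A m \<subseteq> A (Suc m)"
      unfolding A_def by (intro image_mono PiE_mono) auto
    have "(\<lambda>b. \<nu> + b) ` A m \<subseteq> A (Suc m)"
    proof clarify
      fix b assume "b \<in> A m"
      then obtain n where n: "n \<in> PiE F (\<lambda>_. {..m})" "b = (\<Sum>v\<in>F. real (n v) * v)" by (auto simp: A_def)
      have "\<nu> + b = (\<Sum>v\<in>F. real ((n(\<nu> := Suc (n \<nu>))) v) * v)"
        using \<nu> F unfolding n(2) by (subst (1 2) sum.remove[of _ \<nu>]) (auto simp: algebra_simps intro!: sum.cong)
      moreover have "n(\<nu> := Suc (n \<nu>)) \<in> PiE F (\<lambda>_. {..Suc m})"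
        using n(1) \<nu> by (auto simp: PiE_iff extensional_def le_SucI)
      ultimately show "\<nu> + b \<in> A (Suc m)" unfolding A_def by blast
    qed
    \<comment> \<open>\<open>A m\<close> and its translate both lie in \<open>A (Suc m)\<close>,
      which has at most \<open>(1 + \<delta>) * card (A m)\<close> elements. By inclusion-exclusion
      they share at least \<open>(1 - \<delta>) * card (A m)\<close> elements.\<close>
    with mono have "card (A m \<union> (\<lambda>b. \<nu> + b) ` A m) \<le> card (A (Suc m))"
      by (intro card_mono finA) auto
    moreover have "card (A m) + card ((\<lambda>b. \<nu> + b) ` A m)
        = card (A m \<union> (\<lambda>b. \<nu> + b) ` A m) + card (A m \<inter> (\<lambda>b. \<nu> + b) ` A m)"
      by (intro card_Un_Int finA finite_imageI)
    moreover have "card ((\<lambda>b. \<nu> + b) ` A m) = card (A m)" by (intro card_image) (auto simp: inj_on_def)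
    ultimately have "2 * real (card (A m)) \<le> card (A (Suc m)) + card (A m \<inter> (\<lambda>b. \<nu> + b) ` A m)"
      by linarith
    with m have "(1 - \<delta>) * real (card (A m)) \<le> card (A m \<inter> (\<lambda>b. \<nu> + b) ` A m)"
      by (simp add: algebra_simps)
    then have "1 - \<delta> \<le> folner_kernel (A m) \<nu>"
      using finA[of m] A0[of m] by (simp add: folner_kernel_eq card_gt_0_iff le_divide_eq)
    then show ?thesis using folner_kernel_le_1[OF finA, of m \<nu>] \<delta> by simp
  qed
  then show ?thesis by (intro exI[of _ "A m"] conjI finA A0 ballI)
qed

section \<open>Twisted polynomials and Kronecker approximation\<close>

lemma cmod_exp_real_mult: "cmod (exp (of_real \<mu> * s)) = exp (\<mu> * Re s)"
  by simp

text \<open>Termwise estimate. The bound sees \<open>s\<close> only through \<open>Re s\<close>, so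
  it is uniform along a vertical line.\<close>

lemma epoly_multiplier_close:
  fixes c k :: "real \<Rightarrow> complex"
  assumes fin: "finite {\<mu>. c \<mu> \<noteq> 0}" and k: "\<And>\<mu>. c \<mu> \<noteq> 0 \<Longrightarrow> cmod (k \<mu> - 1) \<le> \<delta>"
  shows "cmod (epoly (\<lambda>\<mu>. k \<mu> * c \<mu>) s - epoly c s)
    \<le> \<delta> * (\<Sum>\<mu> | c \<mu> \<noteq> 0. cmod (c \<mu>) * exp (\<mu> * Re s))"
proof -
  have "epoly (\<lambda>\<mu>. k \<mu> * c \<mu>) s - epoly c s = (\<Sum>\<mu> | c \<mu> \<noteq> 0. (k \<mu> - 1) * (c \<mu> * exp (of_real \<mu> * s)))"
    by (subst (1 2) epoly_superset[OF fin]) (auto simp: algebra_simps sum_subtractf)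
  also have "cmod \<dots> \<le> (\<Sum>\<mu> | c \<mu> \<noteq> 0. \<delta> * (cmod (c \<mu>) * exp (\<mu> * Re s)))"
    using k by (intro sum_norm_le) (auto simp: norm_mult intro!: mult_mono)
  finally show ?thesis by (simp add: sum_distrib_left)
qed

text \<open>In \<open>epoly_kernel_bound\<close> take \<open>A\<close> so nearly invariant under the
  finite support that the kernel is almost 1 there; the damping then costs at most
  \<open>e\<close>.\<close>

lemma epoly_character_bound:
  fixes c \<xi> :: "real \<Rightarrow> complex"
  assumes fin: "finite {\<mu>. c \<mu> \<noteq> 0}" and \<xi>: "\<xi> \<in> real_characters"
    and B: "\<And>t. cmod (epoly c (Complex \<sigma> t)) \<le> B"
  shows "cmod (epoly (\<lambda>\<mu>. \<xi> \<mu> * c \<mu>) (Complex \<sigma> t0)) \<le> B"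
proof (rule field_le_epsilon)
  fix e :: real assume e: "e > 0"
  \<comment> \<open>The tolerance \<open>e / (S + 1)\<close> turns the termwise error into at most
    \<open>e\<close>; the summand 1 avoids division by zero.\<close>
  define S where "S = (\<Sum>\<mu> | c \<mu> \<noteq> 0. cmod (c \<mu>) * exp (\<mu> * \<sigma>))"
  have S: "S \<ge> 0" by (auto simp: S_def intro!: sum_nonneg)
  have supp: "{\<mu>. \<xi> \<mu> * c \<mu> \<noteq> 0} = {\<mu>. c \<mu> \<noteq> 0}" using real_charactersD(7)[OF \<xi>] by auto
  obtain A where A: "finite A" "A \<noteq> {}" "\<And>\<mu>. c \<mu> \<noteq> 0 \<Longrightarrow> \<bar>folner_kernel A \<mu> - 1\<bar> \<le> e / (S + 1)"
    using exists_folner_set[OF fin, of "e / (S + 1)"] S e by auto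
  have A': "cmod (complex_of_real (folner_kernel A \<mu>) - 1) \<le> e / (S + 1)" if "c \<mu> \<noteq> 0" for \<mu>
    using A(3)[OF that] norm_of_real[of "folner_kernel A \<mu> - 1", where 'a = complex] by simp
  have "cmod (epoly (\<lambda>\<mu>. folner_kernel A \<mu> * (\<xi> \<mu> * c \<mu>)) (Complex \<sigma> t0) - epoly (\<lambda>\<mu>. \<xi> \<mu> * c \<mu>) (Complex \<sigma> t0))
     \<le> e / (S + 1) * S"
    using epoly_multiplier_close[of "\<lambda>\<mu>. \<xi> \<mu> * c \<mu>" "\<lambda>\<mu>. folner_kernel A \<mu>" "e / (S + 1)" "Complex \<sigma> t0"] A' fin
    unfolding supp by (simp add: S_def norm_mult real_charactersD(1)[OF \<xi>])
  also have "\<dots> \<le> e" using S e by (simp add: field_simps)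
  finally show "cmod (epoly (\<lambda>\<mu>. \<xi> \<mu> * c \<mu>) (Complex \<sigma> t0)) \<le> B + e"
    using epoly_kernel_bound[OF fin A(1,2) \<xi> B, of t0] norm_triangle_sub
      [of "epoly (\<lambda>\<mu>. \<xi> \<mu> * c \<mu>) (Complex \<sigma> t0)" "epoly (\<lambda>\<mu>. folner_kernel A \<mu> * (\<xi> \<mu> * c \<mu>)) (Complex \<sigma> t0)"]
    by (simp add: norm_minus_commute mult.assoc)
qed

text \<open>A sum of \<open>n + 1\<close> unit numbers has modulus near \<open>n + 1\<close> only if they are all near each
  other, so the bound for \<open>1 + \<Sum>\<^sub>\<nu> cnj (\<xi> \<nu>) e\<^sup>\<nu>\<^sup>s\<close>, which the character \<open>\<xi>\<close> turns into \<open>n + 1\<close>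
  at \<open>s = 0\<close>, gives simultaneous approximation.\<close>

lemma kronecker_character:
  assumes F: "finite F" and \<xi>: "\<xi> \<in> real_characters" and \<epsilon>: "\<epsilon> > 0"
  shows "\<exists>t. \<forall>\<nu>\<in>F. cmod (cis (\<nu> * t) - \<xi> \<nu>) < \<epsilon>"
proof -
  \<comment> \<open>The end of the proof needs \<open>4 - (2 - \<delta>)\<^sup>2 \<le> 4 * \<delta>
    \<le> \<epsilon>\<^sup>2\<close>; \<open>\<delta> \<le> 1\<close> keeps
    \<open>2 - \<delta>\<close> nonnegative, so that it can be squared.\<close>
  define \<delta> where "\<delta> = min (\<epsilon>\<^sup>2 / 4) 1"
  have \<delta>: "0 < \<delta>" "\<delta> \<le> 1" "4 * \<delta> \<le> \<epsilon>\<^sup>2" using \<epsilon> by (auto simp: \<delta>_def min_def)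
  \<comment> \<open>The two cases are added because 0 may itself belong to \<open>F\<close>; its
    coefficient is then 2.\<close>
  define c where "c \<mu> = (if \<mu> = 0 then 1 else 0) + (if \<mu> \<in> F then cnj (\<xi> \<mu>) else 0)" for \<mu> :: real
  have fin: "finite {\<mu>. c \<mu> \<noteq> 0}" by (rule finite_subset[of _ "insert 0 F"]) (use F in \<open>auto simp: c_def\<close>)
  have ep: "epoly (\<lambda>\<mu>. h \<mu> * c \<mu>) (Complex 0 t) = h 0 + (\<Sum>\<nu>\<in>F. h \<nu> * cnj (\<xi> \<nu>) * cis (\<nu> * t))" for h t
  proof -
    have "epoly (\<lambda>\<mu>. h \<mu> * c \<mu>) (Complex 0 t) = (\<Sum>\<mu>\<in>insert 0 F. h \<mu> * c \<mu> * cis (\<mu> * t))"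
      by (subst epoly_superset[of "insert 0 F"]) (use F in \<open>auto simp: c_def cis_conv_exp Complex_eq mult_ac split: if_splits\<close>)
    also have "\<dots> = (\<Sum>\<mu>\<in>insert 0 F. (if \<mu> = 0 then h 0 else 0) + (if \<mu> \<in> F then h \<mu> * cnj (\<xi> \<mu>) * cis (\<mu> * t) else 0))"
      by (rule sum.cong) (auto simp: c_def algebra_simps)
    also have "\<dots> = h 0 + (\<Sum>\<nu>\<in>F. h \<nu> * cnj (\<xi> \<nu>) * cis (\<nu> * t))"
    proof -
      have "insert 0 F \<inter> F = F" by auto
      then show ?thesis using F by (simp add: sum.distrib sum.If_cases)
    qed
    finally show ?thesis .
  qed
  have "\<exists>t. cmod (epoly c (Complex 0 t)) > 1 + real (card F) - \<delta>"
  proof (rule ccontr)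
    assume "\<nexists>t. cmod (epoly c (Complex 0 t)) > 1 + real (card F) - \<delta>"
    then have "cmod (epoly c (Complex 0 t)) \<le> 1 + real (card F) - \<delta>" for t by (meson not_le)
    from epoly_character_bound[OF fin \<xi> this, of 0]
    have "cmod (1 + of_nat (card F)) \<le> 1 + real (card F) - \<delta>"
      by (simp add: ep real_charactersD[OF \<xi>])
    also have "cmod (1 + of_nat (card F)) = 1 + real (card F)"
      by (metis norm_of_nat of_nat_Suc add.commute)
    finally show False using \<delta> by simp
  qed
  then obtain t where t: "cmod (epoly c (Complex 0 t)) > 1 + real (card F) - \<delta>" by blast
  define z where "z \<nu> = cnj (\<xi> \<nu>) * cis (\<nu> * t)" for \<nu>
  have z1: "cmod (z \<nu>) = 1" for \<nu> by (simp add: z_def norm_mult real_charactersD(1)[OF \<xi>])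
  have sumz: "cmod (1 + (\<Sum>\<nu>\<in>F. z \<nu>)) > 1 + real (card F) - \<delta>"
    using t ep[of "\<lambda>_. 1" t] by (simp add: z_def)
  have "cmod (cis (\<nu> * t) - \<xi> \<nu>) < \<epsilon>" if \<nu>: "\<nu> \<in> F" for \<nu>
  proof -
    have "1 + (\<Sum>\<nu>\<in>F. z \<nu>) = (1 + z \<nu>) + (\<Sum>\<nu>\<in>F - {\<nu>}. z \<nu>)"
      using sum.remove[OF F \<nu>, of z] by simp
    then have "cmod (1 + (\<Sum>\<nu>\<in>F. z \<nu>)) \<le> cmod (1 + z \<nu>) + cmod (\<Sum>\<nu>\<in>F - {\<nu>}. z \<nu>)"
      by (metis norm_triangle_ineq)
    also have "cmod (\<Sum>\<nu>\<in>F - {\<nu>}. z \<nu>) \<le> real (card (F - {\<nu>})) * 1"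
      by (rule sum_norm_bound) (simp add: z1)
    also have "real (card (F - {\<nu>})) = real (card F) - 1"
      using card_Suc_Diff1[OF F \<nu>] by linarith
    finally have "cmod (1 + z \<nu>) > 2 - \<delta>" using sumz by simp
    then have "(cmod (1 + z \<nu>))\<^sup>2 > (2 - \<delta>)\<^sup>2" using \<delta> by (intro power_strict_mono) auto
    \<comment> \<open>Parallelogram law: a sum of two unit numbers with length near 2 forces a short
      difference.\<close>
    moreover have "(cmod (1 + z \<nu>))\<^sup>2 + (cmod (1 - z \<nu>))\<^sup>2 = 2 + 2 * (cmod (z \<nu>))\<^sup>2"
      by (simp add: cmod_power2) (simp add: power2_eq_square algebra_simps)
    ultimately have "(cmod (1 - z \<nu>))\<^sup>2 < 4 - (2 - \<delta>)\<^sup>2" by (simp add: z1)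
    also have "\<dots> \<le> 4 * \<delta>" by (simp add: power2_eq_square algebra_simps)
    also have "\<dots> \<le> \<epsilon>\<^sup>2" by (rule \<delta>)
    finally have "cmod (1 - z \<nu>) < \<epsilon>" using \<epsilon> by (simp add: power_less_imp_less_base)
    moreover have "cis (\<nu> * t) - \<xi> \<nu> = - \<xi> \<nu> * (1 - z \<nu>)"
      using real_charactersD(5)[OF \<xi>, of \<nu>] by (simp add: z_def algebra_simps)
    ultimately show ?thesis by (simp add: norm_mult real_charactersD(1)[OF \<xi>])
  qed
  then show ?thesis by blast
qed

text \<open>Moving up by \<open>u\<close> multiplies the coefficient at \<open>\<mu>\<close> by
  \<open>cis (\<mu> * u)\<close>, which Kronecker approximation brings close to
  \<open>\<xi> \<mu>\<close> on the whole support. The height obtained is \<open>t\<close> plus this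
  shift.\<close>

lemma epoly_kronecker:
  fixes c \<xi> :: "real \<Rightarrow> complex"
  assumes fin: "finite {\<mu>. c \<mu> \<noteq> 0}" and \<xi>: "\<xi> \<in> real_characters" and \<epsilon>: "\<epsilon> > 0"
  shows "\<exists>u. cmod (epoly c (Complex \<sigma> u) - epoly (\<lambda>\<mu>. \<xi> \<mu> * c \<mu>) (Complex \<sigma> t)) < \<epsilon>"
proof -
  define S where "S = (\<Sum>\<mu> | c \<mu> \<noteq> 0. cmod (c \<mu>) * exp (\<mu> * \<sigma>))"
  have S: "S \<ge> 0" by (auto simp: S_def intro!: sum_nonneg)
  obtain u where u: "\<And>\<mu>. c \<mu> \<noteq> 0 \<Longrightarrow> cmod (cis (\<mu> * u) - \<xi> \<mu>) < \<epsilon> / (S + 1)"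
    using kronecker_character[OF fin \<xi>, of "\<epsilon> / (S + 1)"] \<epsilon> S by auto
  have "epoly c (Complex \<sigma> (t + u)) - epoly (\<lambda>\<mu>. \<xi> \<mu> * c \<mu>) (Complex \<sigma> t)
     = (\<Sum>\<mu> | c \<mu> \<noteq> 0. (cis (\<mu> * u) - \<xi> \<mu>) * (c \<mu> * exp (of_real \<mu> * Complex \<sigma> t)))"
    by (subst (1 2) epoly_superset[OF fin]) (auto simp: exp_vertical_shift algebra_simps sum_subtractf)
  also have "cmod \<dots> \<le> (\<Sum>\<mu> | c \<mu> \<noteq> 0. \<epsilon> / (S + 1) * (cmod (c \<mu>) * exp (\<mu> * \<sigma>)))"
  proof (rule sum_norm_le)
    fix \<mu> assume "\<mu> \<in> {\<mu>. c \<mu> \<noteq> 0}"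
    then have "cmod (cis (\<mu> * u) - \<xi> \<mu>) \<le> \<epsilon> / (S + 1)" using u less_imp_le by blast
    then show "cmod ((cis (\<mu> * u) - \<xi> \<mu>) * (c \<mu> * exp (of_real \<mu> * Complex \<sigma> t)))
        \<le> \<epsilon> / (S + 1) * (cmod (c \<mu>) * exp (\<mu> * \<sigma>))"
      unfolding norm_mult cmod_exp_real_mult complex.sel by (rule mult_right_mono) simp
  qed
  also have "\<dots> = \<epsilon> / (S + 1) * S" by (simp add: sum_distrib_left S_def)
  also have "\<dots> < \<epsilon>" using S \<epsilon> by (simp add: field_simps)
  finally show ?thesis by blast
qed

section \<open>Coefficients of almost periodic functions\<close>

text \<open>\<open>AP\<close> offers a separate polynomial for each strip and tolerance. One
  sequence serving all reduced strips, given by its coefficients, can be twisted termwise and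
  followed to the limit.\<close>

definition ap_limit ::
    "ereal \<Rightarrow> ereal \<Rightarrow> (nat \<Rightarrow> real \<Rightarrow> complex) \<Rightarrow> (complex \<Rightarrow> complex) \<Rightarrow> bool" where
  "ap_limit \<alpha> \<beta> c f \<longleftrightarrow> (\<forall>k. finite {\<mu>. c k \<mu> \<noteq> 0}) \<and>
     (\<forall>\<alpha>1 \<beta>1. \<alpha> < ereal \<alpha>1 \<longrightarrow> \<alpha>1 < \<beta>1 \<longrightarrow> ereal \<beta>1 < \<beta> \<longrightarrow>
       uniform_limit (closed_vstrip \<alpha>1 \<beta>1) (\<lambda>k. epoly (c k)) f sequentially)"

lemma reduced_strip_exists:
  assumes "\<alpha> < ereal \<sigma>" "ereal \<sigma> < \<beta>"
  obtains \<alpha>1 \<beta>1 where "\<alpha> < ereal \<alpha>1" "\<alpha>1 < \<sigma>" "\<sigma> < \<beta>1" "ereal \<beta>1 < \<beta>"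
  using ereal_dense2[OF assms(1)] ereal_dense2[OF assms(2)] by auto

lemma ap_limit_line:
  assumes "ap_limit \<alpha> \<beta> c f" "\<alpha> < ereal \<sigma>" "ereal \<sigma> < \<beta>"
  shows "uniform_limit UNIV (\<lambda>k t. epoly (c k) (Complex \<sigma> t)) (\<lambda>t. f (Complex \<sigma> t)) sequentially"
proof -
  obtain \<alpha>1 \<beta>1 where "\<alpha> < ereal \<alpha>1" "\<alpha>1 < \<sigma>" "\<sigma> < \<beta>1" "ereal \<beta>1 < \<beta>"
    by (rule reduced_strip_exists[OF assms(2,3)])
  then have "uniform_limit (closed_vstrip \<alpha>1 \<beta>1) (\<lambda>k. epoly (c k)) f sequentially"
    using assms(1) unfolding ap_limit_def by auto
  then show ?thesis
    by (rule uniform_limit_compose') (use \<open>\<alpha>1 < \<sigma>\<close> \<open>\<sigma> < \<beta>1\<close> in \<open>auto simp: closed_vstrip_def\<close>)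
qed

lemma ap_limit_pointwise:
  assumes "ap_limit \<alpha> \<beta> c f" "s \<in> vstrip \<alpha> \<beta>"
  shows "(\<lambda>k. epoly (c k) s) \<longlonglongrightarrow> f s"
  using tendsto_uniform_limitI[OF ap_limit_line[OF assms(1), of "Re s"], of "Im s"] assms(2)
  by (simp add: vstrip_def)

lemma ap_limit_imp_AP:
  assumes "ap_limit \<alpha> \<beta> c f"
  shows "f \<in> AP \<alpha> \<beta>"
  unfolding AP_def
proof (clarify)
  fix \<alpha>1 \<beta>1 \<epsilon> :: real
  assume *: "\<alpha> < ereal \<alpha>1" "\<alpha>1 < \<beta>1" "ereal \<beta>1 < \<beta>" "0 < \<epsilon>"
  then have "uniform_limit (closed_vstrip \<alpha>1 \<beta>1) (\<lambda>k. epoly (c k)) f sequentially"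
    using assms unfolding ap_limit_def by auto
  from uniform_limitD[OF this *(4)] obtain k where "\<forall>s\<in>closed_vstrip \<alpha>1 \<beta>1. dist (epoly (c k) s) (f s) < \<epsilon>"
    by (auto dest: eventually_happens)
  then show "\<exists>P. exp_poly P \<and> (\<forall>s\<in>closed_vstrip \<alpha>1 \<beta>1. cmod (f s - P s) < \<epsilon>)"
    using assms unfolding exp_poly_iff_epoly ap_limit_def
    by (intro exI[of _ "epoly (c k)"]) (auto simp: dist_norm norm_minus_commute)
qed

text \<open>Countably many reduced strips suffice, also when an end of the strip is infinite; a
  diagonal choice of polynomials then serves all of them.\<close>

lemma vstrip_exhaustion:
  assumes "\<alpha> < \<beta>"
  shows "\<exists>l u :: nat \<Rightarrow> real. (\<forall>i. \<alpha> < ereal (l i)) \<and> (\<forall>i. l i < u i) \<and> (\<forall>i. ereal (u i) < \<beta>) \<and>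
    (\<forall>\<alpha>1 \<beta>1. \<alpha> < ereal \<alpha>1 \<longrightarrow> ereal \<beta>1 < \<beta> \<longrightarrow>
       (\<forall>\<^sub>F i in sequentially. closed_vstrip \<alpha>1 \<beta>1 \<subseteq> closed_vstrip (l i) (u i)))"
proof -
  show ?thesis
  proof (rule einterval_Icc_approximation[OF assms])
    fix u l :: "nat \<Rightarrow> real"
    assume lu: "\<And>i. l i < u i" "\<And>i. \<alpha> < l i" "\<And>i. u i < \<beta>"
      "(\<lambda>i. ereal (l i)) \<longlonglongrightarrow> \<alpha>" "(\<lambda>i. ereal (u i)) \<longlonglongrightarrow> \<beta>"
    show ?thesis
    proof (rule exI[of _ l], rule exI[of _ u], intro conjI allI impI lu(1-3))
    fix \<alpha>1 \<beta>1 :: real assume *: "\<alpha> < ereal \<alpha>1" "ereal \<beta>1 < \<beta>"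
    have "\<forall>\<^sub>F i in sequentially. ereal (l i) < \<alpha>1 \<and> \<beta>1 < ereal (u i)"
      using order_tendstoD(2)[OF lu(4) *(1)] order_tendstoD(1)[OF lu(5) *(2)] by (rule eventually_conj)
    then show "\<forall>\<^sub>F i in sequentially. closed_vstrip \<alpha>1 \<beta>1 \<subseteq> closed_vstrip (l i) (u i)"
      by eventually_elim (auto simp: closed_vstrip_def)
    qed
  qed
qed

text \<open>For diagonal sequences: the \<open>k\<close>-th approximant is controlled only on the
  \<open>k\<close>-th strip of an exhaustion, which eventually contains any given reduced
  strip.\<close>

lemma uniform_limit_reduced_strips:
  assumes incl: "\<forall>\<^sub>F i in sequentially. S \<subseteq> X i"
    and le: "\<And>k s. s \<in> X k \<Longrightarrow> cmod (P k s - f s) \<le> r k" and r: "r \<longlonglongrightarrow> 0"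
  shows "uniform_limit S P f sequentially"
proof (rule uniform_limitI)
  fix e :: real assume "e > 0"
  then have "\<forall>\<^sub>F k in sequentially. r k < e" using r by (rule order_tendstoD(2)[rotated])
  with incl show "\<forall>\<^sub>F k in sequentially. \<forall>s\<in>S. dist (P k s) (f s) < e"
    by eventually_elim (use le in \<open>force simp: dist_norm\<close>)
qed

lemma AP_imp_ap_limit:
  assumes "\<alpha> < \<beta>" "f \<in> AP \<alpha> \<beta>"
  obtains c where "ap_limit \<alpha> \<beta> c f"
proof -
  obtain l u :: "nat \<Rightarrow> real" where lu: "\<And>i. \<alpha> < ereal (l i)" "\<And>i. l i < u i" "\<And>i. ereal (u i) < \<beta>"
    "\<And>\<alpha>1 \<beta>1. \<alpha> < ereal \<alpha>1 \<Longrightarrow> ereal \<beta>1 < \<beta> \<Longrightarrow>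
       \<forall>\<^sub>F i in sequentially. closed_vstrip \<alpha>1 \<beta>1 \<subseteq> closed_vstrip (l i) (u i)"
    using vstrip_exhaustion[OF assms(1)] by metis
  have "\<exists>c. finite {\<mu>. c \<mu> \<noteq> 0} \<and> (\<forall>s\<in>closed_vstrip (l k) (u k). cmod (f s - epoly c s) < inverse (real (Suc k)))" for k
  proof -
    have "\<exists>P. exp_poly P \<and> (\<forall>s\<in>closed_vstrip (l k) (u k). cmod (f s - P s) < inverse (real (Suc k)))"
      using assms(2) lu(1-3) unfolding AP_def by (auto simp del: of_nat_Suc)
    then show ?thesis unfolding exp_poly_iff_epoly by blast
  qed
  then obtain c where c: "\<And>k. finite {\<mu>. c k \<mu> \<noteq> 0}"
    "\<And>k s. s \<in> closed_vstrip (l k) (u k) \<Longrightarrow> cmod (f s - epoly (c k) s) < inverse (real (Suc k))"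
    by metis
  have "ap_limit \<alpha> \<beta> c f"
    unfolding ap_limit_def
  proof (intro conjI allI impI c(1))
    fix \<alpha>1 \<beta>1 assume *: "\<alpha> < ereal \<alpha>1" "\<alpha>1 < \<beta>1" "ereal \<beta>1 < \<beta>"
    show "uniform_limit (closed_vstrip \<alpha>1 \<beta>1) (\<lambda>k. epoly (c k)) f sequentially"
      by (rule uniform_limit_reduced_strips[OF lu(4)[OF *(1,3)] _ LIMSEQ_inverse_real_of_nat])
        (use c(2) in \<open>auto simp: norm_minus_commute less_imp_le simp del: of_nat_Suc\<close>)
  qed
  then show ?thesis by (rule that)
qed

text \<open>The coefficients of the approximants are means along vertical lines, and uniform
  convergence on a line passes to means. The same argument shows that the mean of \<open>f\<close>
  exists and does not depend on the line, so the description in \<open>dirichlet_coeff\<close>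
  denotes it.\<close>

lemma ap_limit_coeff:
  assumes ab: "\<alpha> < \<beta>" and lim: "ap_limit \<alpha> \<beta> c f"
  shows "(\<lambda>k. c k \<nu>) \<longlonglongrightarrow> dirichlet_coeff \<alpha> \<beta> f \<nu>"
proof -
  define w where "w \<sigma> t = exp (- (of_real \<nu> * Complex \<sigma> t))" for \<sigma> t
  have w: "cmod (w \<sigma> t) = exp (- (\<nu> * \<sigma>))" for \<sigma> t by (simp add: w_def)
  have cw: "continuous_on UNIV (w \<sigma>)" for \<sigma> unfolding w_def Complex_eq by (intro continuous_intros)
  define g where "g \<sigma> k t = epoly (c k) (Complex \<sigma> t) * w \<sigma> t" for \<sigma> k t
  have cg: "continuous_on UNIV (g \<sigma> k)" for \<sigma> k
    unfolding g_def by (intro continuous_intros continuous_on_epoly_line cw)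
  have mg: "has_mean (g \<sigma> k) (c k \<nu>)" for \<sigma> k
    unfolding g_def w_def using lim by (intro has_mean_epoly) (auto simp: ap_limit_def)
  have unif: "uniform_limit UNIV (g \<sigma>) (\<lambda>t. f (Complex \<sigma> t) * w \<sigma> t) sequentially"
    if \<sigma>: "\<alpha> < ereal \<sigma>" "ereal \<sigma> < \<beta>" for \<sigma>
  proof (rule uniform_limitI)
    fix e :: real assume e: "e > 0"
    have "\<forall>\<^sub>F k in sequentially. \<forall>t\<in>UNIV. dist (epoly (c k) (Complex \<sigma> t)) (f (Complex \<sigma> t)) < e / exp (- (\<nu> * \<sigma>))"
      by (rule uniform_limitD[OF ap_limit_line[OF lim \<sigma>]]) (use e in simp)
    then show "\<forall>\<^sub>F k in sequentially. \<forall>t\<in>UNIV. dist (g \<sigma> k t) (f (Complex \<sigma> t) * w \<sigma> t) < e"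
    proof (eventually_elim, intro ballI)
      fix k t
      assume "\<forall>t\<in>UNIV. dist (epoly (c k) (Complex \<sigma> t)) (f (Complex \<sigma> t)) < e / exp (- (\<nu> * \<sigma>))"
      then have "dist (epoly (c k) (Complex \<sigma> t)) (f (Complex \<sigma> t)) * exp (- (\<nu> * \<sigma>)) < e"
        by (simp add: less_divide_eq)
      then show "dist (g \<sigma> k t) (f (Complex \<sigma> t) * w \<sigma> t) < e"
        unfolding g_def dist_norm left_diff_distrib[symmetric] norm_mult w .
    qed
  qed
  obtain \<sigma>0 where \<sigma>0: "\<alpha> < ereal \<sigma>0" "ereal \<sigma>0 < \<beta>" using ereal_dense2[OF ab] by blast
  \<comment> \<open>The limit has to be produced first, since no mean of \<open>f\<close> is known
    yet: polynomials close on one line have close coefficients.\<close>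
  have "Cauchy (\<lambda>k. c k \<nu>)"
  proof (rule metric_CauchyI)
    fix e :: real assume e: "e > 0"
    then obtain K where K: "\<And>k t. k \<ge> K \<Longrightarrow> dist (g \<sigma>0 k t) (f (Complex \<sigma>0 t) * w \<sigma>0 t) < e / 4"
      using uniform_limitD[OF unif[OF \<sigma>0], of "e / 4"] by (auto simp: eventually_sequentially)
    have "dist (c k \<nu>) (c m \<nu>) < e" if "k \<ge> K" "m \<ge> K" for k m
    proof -
      have "cmod (g \<sigma>0 k t - g \<sigma>0 m t) \<le> e / 2" for t
        using K[OF that(1), of t] K[OF that(2), of t] unfolding dist_norm[symmetric] by metric
      from has_mean_diff_bound[OF cg cg mg mg this] show ?thesis using e by (simp add: dist_norm)
    qed
    then show "\<exists>M. \<forall>m\<ge>M. \<forall>n\<ge>M. dist (c m \<nu>) (c n \<nu>) < e" by blast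
  qed
  then obtain a where a: "(\<lambda>k. c k \<nu>) \<longlonglongrightarrow> a"
    using Cauchy_convergent convergent_def by blast
  have mean: "has_mean (\<lambda>t. f (Complex \<sigma> t) * w \<sigma> t) a" if "\<alpha> < ereal \<sigma>" "ereal \<sigma> < \<beta>" for \<sigma>
    by (rule has_mean_uniform_limit[OF cg mg a unif[OF that]])
  have "dirichlet_coeff \<alpha> \<beta> f \<nu> = a"
    unfolding dirichlet_coeff_def w_def[symmetric] has_mean_def[symmetric]
    by (rule the_equality) (use mean \<sigma>0 has_mean_unique in blast)+
  with a show ?thesis by simp
qed

section \<open>Bochner-Fejer summation\<close>

text \<open>Convolution with a Folner kernel multiplies the coefficients of a polynomial by the kernel and does
  not increase suprema along vertical lines.\<close>

lemma bochner_fejer_approximation: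
  fixes lam :: "nat \<Rightarrow> real"
  assumes ab: "\<alpha> < \<beta>" and f: "f \<in> AP \<alpha> \<beta>"
  shows "\<exists>\<kappa> :: nat \<Rightarrow> real \<Rightarrow> real. (\<forall>k. finite {\<nu>. \<kappa> k \<nu> \<noteq> 0}) \<and> (\<forall>j. (\<lambda>k. \<kappa> k (lam j)) \<longlonglongrightarrow> 1) \<and>
    ap_limit \<alpha> \<beta> (\<lambda>k \<nu>. of_real (\<kappa> k \<nu>) * dirichlet_coeff \<alpha> \<beta> f \<nu>) f"
proof -
  obtain l u :: "nat \<Rightarrow> real" where lu: "\<And>i. \<alpha> < ereal (l i)" "\<And>i. l i < u i" "\<And>i. ereal (u i) < \<beta>"
    "\<And>\<alpha>1 \<beta>1. \<alpha> < ereal \<alpha>1 \<Longrightarrow> ereal \<beta>1 < \<beta> \<Longrightarrow>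
       \<forall>\<^sub>F i in sequentially. closed_vstrip \<alpha>1 \<beta>1 \<subseteq> closed_vstrip (l i) (u i)"
    using vstrip_exhaustion[OF ab] by metis
  obtain c where c: "ap_limit \<alpha> \<beta> c f" using AP_imp_ap_limit[OF ab f] .
  define r where "r k = inverse (real (Suc k))" for k
  have r: "r k > 0" "r \<longlonglongrightarrow> 0" for k
    using LIMSEQ_inverse_real_of_nat unfolding r_def by auto
  have "\<exists>d. finite {\<mu>. d \<mu> \<noteq> 0} \<and> (\<forall>s\<in>closed_vstrip (l k) (u k). cmod (epoly d s - f s) \<le> r k)" for k
  proof -
    have "uniform_limit (closed_vstrip (l k) (u k)) (\<lambda>k. epoly (c k)) f sequentially"
      using c lu(1-3) unfolding ap_limit_def by blast
    from uniform_limitD[OF this r(1)[of k]] obtain m where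
      "\<forall>s\<in>closed_vstrip (l k) (u k). dist (epoly (c m) s) (f s) < r k"
      by (auto dest: eventually_happens)
    then show ?thesis using c unfolding ap_limit_def dist_norm by (meson less_imp_le)
  qed
  then obtain d where d: "\<And>k. finite {\<mu>. d k \<mu> \<noteq> 0}"
    "\<And>k s. s \<in> closed_vstrip (l k) (u k) \<Longrightarrow> cmod (epoly (d k) s - f s) \<le> r k"
    by metis
  \<comment> \<open>For each sign of \<open>\<mu>\<close> the exponential is largest at one edge of
    the strip, so the sum over both edges bounds it throughout.\<close>
  define S where "S k = (\<Sum>\<mu> | d k \<mu> \<noteq> 0. cmod (d k \<mu>) * (exp (\<mu> * l k) + exp (\<mu> * u k)))" for k
  have S: "S k \<ge> 0" for k by (auto simp: S_def intro!: sum_nonneg)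
  have Sle: "(\<Sum>\<mu> | d k \<mu> \<noteq> 0. cmod (d k \<mu>) * exp (\<mu> * Re s)) \<le> S k"
    if "s \<in> closed_vstrip (l k) (u k)" for k s
    unfolding S_def
  proof (intro sum_mono mult_left_mono)
    fix \<mu>
    have "\<mu> * Re s \<le> \<mu> * l k \<or> \<mu> * Re s \<le> \<mu> * u k"
      using that by (cases "\<mu> \<ge> 0") (auto simp: closed_vstrip_def mult_left_mono mult_left_mono_neg)
    then show "exp (\<mu> * Re s) \<le> exp (\<mu> * l k) + exp (\<mu> * u k)"
      by (auto simp: add_increasing add_increasing2)
  qed simp
  \<comment> \<open>Two demands on \<open>A k\<close>: near invariance under the frequencies of
    \<open>d k\<close> keeps \<open>d k\<close> almost unchanged, and under
    \<open>lam 0, ..., lam k\<close> it makes the factors at every fixed \<open>lam j\<close> tend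
    to 1.\<close>
  have "\<exists>A. finite A \<and> A \<noteq> {} \<and> (\<forall>\<nu>\<in>{\<mu>. d k \<mu> \<noteq> 0} \<union> lam ` {..k}. \<bar>folner_kernel A \<nu> - 1\<bar> \<le> r k / (S k + 1))" for k
    using d(1)[of k] S[of k] r(1)[of k] by (intro exists_folner_set) auto
  then obtain A where A: "\<And>k. finite (A k)" "\<And>k. A k \<noteq> {}"
    "\<And>k \<nu>. \<nu> \<in> {\<mu>. d k \<mu> \<noteq> 0} \<union> lam ` {..k} \<Longrightarrow> \<bar>folner_kernel (A k) \<nu> - 1\<bar> \<le> r k / (S k + 1)"
    by metis
  define \<kappa> where "\<kappa> k = folner_kernel (A k)" for k
  have rS: "r k / (S k + 1) \<le> r k" for k using r(1)[of k] S[of k] by (simp add: field_simps)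
  let ?a = "\<lambda>k \<nu>. of_real (\<kappa> k \<nu>) * dirichlet_coeff \<alpha> \<beta> f \<nu>"
  have fin\<kappa>: "finite {\<nu>. \<kappa> k \<nu> \<noteq> 0}" for k
    unfolding \<kappa>_def by (rule finite_support_folner_kernel[OF A(1)])
  have fina: "finite {\<nu>. of_real (\<kappa> k \<nu>) * c' \<nu> \<noteq> (0 :: complex)}" for k c'
    by (rule finite_subset[OF _ fin\<kappa>[of k]]) auto
  have one: "(\<lambda>_. 1) \<in> real_characters" by (simp add: real_characters_def)
  \<comment> \<open>Three errors of size \<open>r k\<close>: damped \<open>f\<close> against damped
    \<open>d k\<close>, damped \<open>d k\<close> against \<open>d k\<close>, and \<open>d k\<close>
    against \<open>f\<close>.\<close>
  have main: "cmod (epoly (?a k) s - f s) \<le> 3 * r k" if s: "s \<in> closed_vstrip (l k) (u k)" for k s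
  proof -
    have 1: "cmod (epoly (?a k) s - epoly (\<lambda>\<nu>. of_real (\<kappa> k \<nu>) * d k \<nu>) s) \<le> r k"
    proof -
      \<comment> \<open>The kernel bound is available for polynomials only, so \<open>f\<close> is
        replaced by the approximants \<open>c m\<close>. The kernel has finite support, so
        convergence of the coefficients gives convergence of the damped values.\<close>
      have tendsto: "(\<lambda>m. epoly (\<lambda>\<nu>. of_real (\<kappa> k \<nu>) * c m \<nu>) s) \<longlonglongrightarrow> epoly (?a k) s"
      proof -
        have e: "epoly (\<lambda>\<nu>. of_real (\<kappa> k \<nu>) * c' \<nu>) s
            = (\<Sum>\<nu> | \<kappa> k \<nu> \<noteq> 0. of_real (\<kappa> k \<nu>) * c' \<nu> * exp (of_real \<nu> * s))" for c'
          by (rule epoly_superset[OF fin\<kappa>]) auto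
        show ?thesis unfolding e by (intro tendsto_intros ap_limit_coeff[OF ab c])
      qed
      have "\<forall>\<^sub>F m in sequentially. cmod (epoly (\<lambda>\<nu>. of_real (\<kappa> k \<nu>) * c m \<nu>) s
              - epoly (\<lambda>\<nu>. of_real (\<kappa> k \<nu>) * d k \<nu>) s) \<le> r k + \<epsilon>" if \<epsilon>: "\<epsilon> > 0" for \<epsilon>
      proof -
        have "uniform_limit (closed_vstrip (l k) (u k)) (\<lambda>k. epoly (c k)) f sequentially"
          using c lu(1-3) unfolding ap_limit_def by blast
        from uniform_limitD[OF this \<epsilon>] show ?thesis
        proof eventually_elim
          case (elim m)
          have fc: "finite {\<mu>. c m \<mu> \<noteq> 0}" using c by (simp add: ap_limit_def)
          have "cmod (epoly (\<lambda>\<mu>. c m \<mu> - d k \<mu>) (Complex (Re s) t)) \<le> r k + \<epsilon>" for t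
          proof -
            have z: "Complex (Re s) t \<in> closed_vstrip (l k) (u k)" using s by (simp add: closed_vstrip_def)
            show ?thesis
              unfolding epoly_diff[OF fc d(1)] dist_norm[symmetric]
              using elim[rule_format, OF z] d(2)[OF z] unfolding dist_norm[symmetric] by metric
          qed
          from epoly_kernel_bound[OF finite_support_diff[OF fc d(1)] A(1,2) one this, of k "Im s"]
          have "cmod (epoly (\<lambda>\<mu>. of_real (\<kappa> k \<mu>) * c m \<mu> - of_real (\<kappa> k \<mu>) * d k \<mu>) s) \<le> r k + \<epsilon>"
            by (simp add: \<kappa>_def right_diff_distrib)
          then show ?case by (subst (asm) epoly_diff) (rule fina)+
        qed
      qed
      then have "cmod (epoly (?a k) s - epoly (\<lambda>\<nu>. of_real (\<kappa> k \<nu>) * d k \<nu>) s) \<le> r k + \<epsilon>" if "\<epsilon> > 0" for \<epsilon>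
        using that by (intro tendsto_upperbound[OF tendsto_norm[OF tendsto_diff[OF tendsto tendsto_const]]]) auto
      then show ?thesis by (rule field_le_epsilon)
    qed
    have 2: "cmod (epoly (\<lambda>\<nu>. of_real (\<kappa> k \<nu>) * d k \<nu>) s - epoly (d k) s) \<le> r k"
    proof -
      have "cmod (complex_of_real (\<kappa> k \<mu>) - 1) \<le> r k / (S k + 1)" if "d k \<mu> \<noteq> 0" for \<mu>
        using A(3)[of \<mu> k] that norm_of_real[of "\<kappa> k \<mu> - 1", where 'a = complex] by (simp add: \<kappa>_def)
      from epoly_multiplier_close[OF d(1) this, where s = s]
      have "cmod (epoly (\<lambda>\<nu>. of_real (\<kappa> k \<nu>) * d k \<nu>) s - epoly (d k) s) \<le> r k / (S k + 1) * S k"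
        using Sle[OF s] r(1)[of k] S[of k]
        by (meson divide_nonneg_nonneg add_nonneg_nonneg less_imp_le mult_left_mono order_trans zero_le_one)
      also have "\<dots> \<le> r k" using r(1)[of k] S[of k] by (simp add: field_simps)
      finally show ?thesis .
    qed
    show ?thesis using 1 2 d(2)[OF s] unfolding dist_norm[symmetric] by metric
  qed
  show ?thesis
  proof (rule exI[of _ \<kappa>], intro conjI allI fin\<kappa>)
    show "(\<lambda>k. \<kappa> k (lam j)) \<longlonglongrightarrow> 1" for j
    proof (rule LIM_zero_cancel, rule Lim_null_comparison[OF _ r(2)])
      show "\<forall>\<^sub>F k in sequentially. norm (\<kappa> k (lam j) - 1) \<le> r k"
        using eventually_ge_at_top[of j]
      proof eventually_elim
        case (elim k)
        then have "lam j \<in> {\<mu>. d k \<mu> \<noteq> 0} \<union> lam ` {..k}" by auto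
        from order_trans[OF A(3)[OF this] rS] show ?case by (simp add: \<kappa>_def)
      qed
    qed
    show "ap_limit \<alpha> \<beta> ?a f"
      unfolding ap_limit_def
    proof (intro conjI allI impI fina)
      fix \<alpha>1 \<beta>1 assume *: "\<alpha> < ereal \<alpha>1" "\<alpha>1 < \<beta>1" "ereal \<beta>1 < \<beta>"
      show "uniform_limit (closed_vstrip \<alpha>1 \<beta>1) (\<lambda>k. epoly (?a k)) f sequentially"
        by (rule uniform_limit_reduced_strips[OF lu(4)[OF *(1,3)] main]) (use tendsto_mult_right_zero[OF r(2)] in auto)
    qed
  qed
qed

text \<open>Uniqueness theorem: all coefficients of the difference vanish, hence so do its
  Bochner-Fejer polynomials, which converge to it.\<close>

lemma AP_eqI:
  assumes ab: "\<alpha> < \<beta>" and f: "f \<in> AP \<alpha> \<beta>" and g: "g \<in> AP \<alpha> \<beta>"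
    and eq: "\<And>\<nu>. dirichlet_coeff \<alpha> \<beta> f \<nu> = dirichlet_coeff \<alpha> \<beta> g \<nu>" and s: "s \<in> vstrip \<alpha> \<beta>"
  shows "f s = g s"
proof -
  obtain c where c: "ap_limit \<alpha> \<beta> c f" using AP_imp_ap_limit[OF ab f] .
  obtain d where d: "ap_limit \<alpha> \<beta> d g" using AP_imp_ap_limit[OF ab g] .
  have fin: "finite {\<mu>. c k \<mu> \<noteq> 0}" "finite {\<mu>. d k \<mu> \<noteq> 0}" for k
    using c d by (auto simp: ap_limit_def)
  have *: "ap_limit \<alpha> \<beta> (\<lambda>k \<mu>. c k \<mu> - d k \<mu>) (\<lambda>s. f s - g s)"
    unfolding ap_limit_def
  proof (intro conjI allI impI finite_support_diff fin)
    fix \<alpha>1 \<beta>1 assume "\<alpha> < ereal \<alpha>1" "\<alpha>1 < \<beta>1" "ereal \<beta>1 < \<beta>"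
    then have "uniform_limit (closed_vstrip \<alpha>1 \<beta>1) (\<lambda>k s. epoly (c k) s - epoly (d k) s) (\<lambda>s. f s - g s) sequentially"
      using c d unfolding ap_limit_def by (intro uniform_limit_intros) auto
    then show "uniform_limit (closed_vstrip \<alpha>1 \<beta>1) (\<lambda>k. epoly (\<lambda>\<mu>. c k \<mu> - d k \<mu>)) (\<lambda>s. f s - g s) sequentially"
      by (subst ext[OF epoly_diff[OF fin]])
  qed
  have "dirichlet_coeff \<alpha> \<beta> (\<lambda>s. f s - g s) \<nu> = 0" for \<nu>
    using LIMSEQ_unique[OF ap_limit_coeff[OF ab *] tendsto_diff[OF ap_limit_coeff[OF ab c] ap_limit_coeff[OF ab d]]] eq
    by simp
  moreover obtain \<kappa> :: "nat \<Rightarrow> real \<Rightarrow> real" where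
    "ap_limit \<alpha> \<beta> (\<lambda>k \<nu>. of_real (\<kappa> k \<nu>) * dirichlet_coeff \<alpha> \<beta> (\<lambda>s. f s - g s) \<nu>) (\<lambda>s. f s - g s)"
    using bochner_fejer_approximation[OF ab ap_limit_imp_AP[OF *]] by blast
  ultimately have "(\<lambda>k. epoly (\<lambda>_. 0) s) \<longlonglongrightarrow> f s - g s"
    using ap_limit_pointwise[OF _ s] by fastforce
  then show ?thesis by (simp add: epoly_def LIMSEQ_const_iff)
qed

section \<open>Equivalence and characters\<close>

text \<open>Tychonoff's theorem for a product of circles; multiplicativity is a closed condition in
  the topology of pointwise convergence.\<close>

lemma compact_real_characters: "compact real_characters"
proof -
  have "compact (PiE UNIV (\<lambda>_. sphere 0 1) :: (real \<Rightarrow> complex) set)"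
    using compactin_PiE[of "\<lambda>_. euclidean" UNIV "\<lambda>_. sphere (0 :: complex) 1"]
    by (simp add: euclidean_product_topology)
  moreover have "closed {\<eta> :: real \<Rightarrow> complex. \<forall>x y. \<eta> (x + y) = \<eta> x * \<eta> y}"
    by (intro closed_Collect_all closed_Collect_eq continuous_intros continuous_on_product_coordinates)
  ultimately have "compact (PiE UNIV (\<lambda>_. sphere 0 1) \<inter> {\<eta> :: real \<Rightarrow> complex. \<forall>x y. \<eta> (x + y) = \<eta> x * \<eta> y})"
    by (rule compact_Int_closed)
  also have "PiE UNIV (\<lambda>_. sphere 0 1) \<inter> {\<eta> :: real \<Rightarrow> complex. \<forall>x y. \<eta> (x + y) = \<eta> x * \<eta> y} = real_characters"
    by (auto simp: real_characters_def PiE_iff)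
  finally show ?thesis .
qed

text \<open>The maps \<open>\<psi>\<^sub>n\<close> of the definition of equivalence need not be compatible; compactness of the
  character group replaces them by one character.\<close>

lemma exists_character:
  fixes a b :: "nat \<Rightarrow> complex"
  assumes ex: "\<And>n. enat n \<le> N \<Longrightarrow> \<exists>\<xi>\<in>real_characters. \<forall>j<n. b j = a j * \<xi> (lam j)"
  shows "\<exists>\<xi>\<in>real_characters. \<forall>j\<in>idx N. b j = a j * \<xi> (lam j)"
proof -
  have "real_characters \<inter> (\<Inter>j\<in>idx N. {\<xi>. b j = a j * \<xi> (lam j)}) \<noteq> {}"
  proof (rule compact_imp_fip_image[OF compact_real_characters])
    show "closed {\<xi>. b j = a j * \<xi> (lam j)}" for j
      by (intro closed_Collect_eq continuous_intros continuous_on_product_coordinates)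
    fix I assume I: "finite I" "I \<subseteq> idx N"
    \<comment> \<open>Finitely many conditions lie within one initial segment, where a character is
      given; the finite intersection property does the rest.\<close>
    obtain n where n: "enat n \<le> N" "\<And>j. j \<in> I \<Longrightarrow> j < n"
    proof (cases "I = {}")
      case True then show ?thesis using that[of 0] by (simp add: zero_enat_def[symmetric])
    next
      case False
      then have "Max I \<in> idx N" using Max_in I by blast
      then show ?thesis using that[of "Suc (Max I)"] I Max_ge by (auto simp: idx_def Suc_ile_eq less_Suc_eq_le)
    qed
    show "real_characters \<inter> (\<Inter>j\<in>I. {\<xi>. b j = a j * \<xi> (lam j)}) \<noteq> {}"
      using ex[OF n(1)] n(2) by fast
  qed
  then show ?thesis by blast
qed

lemma cis_additive_character: "(\<And>x y. \<psi> (x + y) = \<psi> x + \<psi> y) \<Longrightarrow> (\<lambda>x. cis (\<psi> x)) \<in> real_characters"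
  by (simp add: real_characters_def cis_mult)

lemma character_mult: "\<xi> \<in> real_characters \<Longrightarrow> \<eta> \<in> real_characters \<Longrightarrow> (\<lambda>x. \<xi> x * \<eta> x) \<in> real_characters"
  by (simp add: real_characters_def norm_mult)

lemma character_cnj: "\<xi> \<in> real_characters \<Longrightarrow> (\<lambda>x. cnj (\<xi> x)) \<in> real_characters"
  by (simp add: real_characters_def)

lemma character_sum:
  "\<xi> \<in> real_characters \<Longrightarrow> \<xi> (\<Sum>i\<in>I. h i) = (\<Prod>i\<in>I. \<xi> (h i))"
  by (induction I rule: infinite_finite_induct) (simp_all add: real_charactersD)

lemma cis_eq_imp: "cis x = cis y \<Longrightarrow> \<exists>n::int. x = y + 2 * pi * n"
  using sin_cos_eq_iff[of x y] by (simp add: complex_eq_iff)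

text \<open>An angle of \<open>\<xi> y\<close> determines \<open>\<xi>\<close> at integer multiples
  of \<open>y\<close>, but not at its fractions.\<close>

lemma character_of_int_mult:
  assumes \<xi>: "\<xi> \<in> real_characters" and y: "\<xi> y = cis \<theta>"
  shows "\<xi> (of_int m * y) = cis (of_int m * \<theta>)"
proof -
  have nat: "\<xi> (real n * y) = cis (real n * \<theta>)" for n
    by (induction n) (simp_all add: real_charactersD[OF \<xi>] distrib_right y cis_mult)
  show ?thesis
  proof (cases "m \<ge> 0")
    case True then show ?thesis using nat[of "nat m"] by simp
  next
    case False
    then show ?thesis
      using nat[of "nat (- m)"] real_charactersD(4)[OF \<xi>, of "real (nat (- m)) * y"] by (simp add: cis_cnj)
  qed
qed

interpretation rat_vs_pair: vector_space_pair rat_scale rat_scale ..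

lemma rat_linear_add:
  "Vector_Spaces.linear rat_scale rat_scale \<psi> \<Longrightarrow> \<psi> (x + y) = \<psi> x + \<psi> y"
  by (rule rat_vs_pair.linear_add)

text \<open>An additive map on all reals is wanted, because only then is its \<open>cis\<close> a
  character.\<close>

lemma rat_linear_on_extend:
  assumes "rat_linear_on (rat_vs.span S) \<psi>"
  obtains \<phi> where "Vector_Spaces.linear rat_scale rat_scale \<phi>" "\<And>x. x \<in> rat_vs.span S \<Longrightarrow> \<phi> x = \<psi> x"
proof -
  have add: "\<psi> (x + y) = \<psi> x + \<psi> y" if "x \<in> rat_vs.span S" "y \<in> rat_vs.span S" for x y
    using assms that by (simp add: rat_linear_on_def)
  have scale: "\<psi> (rat_scale q x) = rat_scale q (\<psi> x)" if "x \<in> rat_vs.span S" for q x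
    using assms that by (simp add: rat_linear_on_def)
  have zero: "\<psi> 0 = 0" using add[of 0 0] rat_vs.span_zero[of S] by simp
  obtain B where B: "B \<subseteq> S" "rat_vs.independent B" "S \<subseteq> rat_vs.span B"
    by (rule rat_vs.maximal_independent_subset)
  obtain \<phi> where \<phi>: "Vector_Spaces.linear rat_scale rat_scale \<phi>" "\<forall>x\<in>B. \<phi> x = \<psi> x"
    using rat_vs_pair.linear_independent_extend[OF B(2), of \<psi>] by blast
  have "rat_vs.span B \<subseteq> {x \<in> rat_vs.span S. \<phi> x = \<psi> x}"
  proof (rule rat_vs.span_minimal)
    show "B \<subseteq> {x \<in> rat_vs.span S. \<phi> x = \<psi> x}" using \<phi>(2) B(1) rat_vs.span_base by blast
    show "rat_vs.subspace {x \<in> rat_vs.span S. \<phi> x = \<psi> x}"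
      unfolding rat_vs.subspace_def
      by (auto simp: rat_vs.span_zero rat_vs.span_add rat_vs.span_scale add scale zero
          rat_vs_pair.linear_0[OF \<phi>(1)] rat_vs_pair.linear_add[OF \<phi>(1)] rat_vs_pair.linear_scale[OF \<phi>(1)])
  qed
  moreover have "rat_vs.span S \<subseteq> rat_vs.span B" using B(3) rat_vs.span_minimal rat_vs.subspace_span by blast
  ultimately show ?thesis using that[OF \<phi>(1)] by blast
qed

text \<open>On each initial segment the extension of \<open>\<psi>\<close> gives a character, and
  compactness merges these. The definition says nothing for \<open>n = 0\<close>, where the trivial
  character serves.\<close>

lemma AP_equiv_imp_character:
  assumes "AP_equiv \<alpha> \<beta> lam N f1 f2"
  shows "\<exists>\<xi>\<in>real_characters. \<forall>j\<in>idx N.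
    dirichlet_coeff \<alpha> \<beta> f2 (lam j) = dirichlet_coeff \<alpha> \<beta> f1 (lam j) * \<xi> (lam j)"
proof (rule exists_character)
  fix n assume n: "enat n \<le> N"
  show "\<exists>\<xi>\<in>real_characters. \<forall>j<n.
    dirichlet_coeff \<alpha> \<beta> f2 (lam j) = dirichlet_coeff \<alpha> \<beta> f1 (lam j) * \<xi> (lam j)"
  proof (cases "n = 0")
    case True
    then show ?thesis using cis_additive_character[of "\<lambda>_. 0"] by auto
  next
    case False
    then obtain \<psi> where \<psi>: "rat_linear_on (rat_vs.span (lam ` {..<n})) \<psi>"
      "\<And>j. j < n \<Longrightarrow> dirichlet_coeff \<alpha> \<beta> f2 (lam j) =
               dirichlet_coeff \<alpha> \<beta> f1 (lam j) * exp (\<i> * of_real (\<psi> (lam j)))"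
      using assms n unfolding AP_equiv_def by (metis One_nat_def Suc_leI neq0_conv)
    obtain \<phi> where \<phi>: "Vector_Spaces.linear rat_scale rat_scale \<phi>"
        "\<And>x. x \<in> rat_vs.span (lam ` {..<n}) \<Longrightarrow> \<phi> x = \<psi> x"
      using rat_linear_on_extend[OF \<psi>(1)] by metis
    show ?thesis
      by (rule bexI[OF _ cis_additive_character[OF rat_linear_add[OF \<phi>(1)]]])
        (auto simp: \<psi>(2) \<phi>(2) rat_vs.span_base cis_conv_exp)
  qed
qed

section \<open>The natural basis, coordinate pairings and lifts of characters\<close>

lemma kept_mono: "m \<le> n \<Longrightarrow> kept lam m \<subseteq> kept lam n"
  by (induction n rule: dec_induct) auto

lemma independent_kept: "rat_vs.independent (kept lam n)"
  by (induction n) (auto simp: rat_vs.independent_empty)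

lemma independent_natural_basis: "rat_vs.independent (natural_basis lam N)"
  unfolding natural_basis_def
proof (rule rat_vs.independent_Union_directed)
  fix c d assume "c \<in> kept lam ` {n. enat n \<le> N}" "d \<in> kept lam ` {n. enat n \<le> N}"
  then show "c \<subseteq> d \<or> d \<subseteq> c" using kept_mono by (metis imageE nat_le_linear)
qed (use independent_kept in auto)

lemma lam_in_span_natural_basis:
  assumes "j \<in> idx N"
  shows "lam j \<in> rat_vs.span (natural_basis lam N)"
proof -
  have "lam j \<in> rat_vs.span (kept lam (Suc j))"
    using independent_kept[of lam j] by (auto simp: rat_vs.independent_insert rat_vs.span_base split: if_splits)
  moreover have "kept lam (Suc j) \<subseteq> natural_basis lam N"
    unfolding natural_basis_def using assms by (intro UN_upper) (simp add: idx_def Suc_ile_eq)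
  ultimately show ?thesis using rat_vs.span_mono by blast
qed

text \<open>Translates between coordinate vectors and rational-linear maps: a vector prescribes the
  values on the basis, and pairing evaluates the resulting map at \<open>lam j\<close>.\<close>

lemma pairing_eq_linear:
  assumes \<psi>: "Vector_Spaces.linear rat_scale rat_scale \<psi>"
    and y: "\<And>g. g \<in> natural_basis lam N \<Longrightarrow> \<psi> g = y g" and j: "j \<in> idx N"
  shows "pairing lam N j y = \<psi> (lam j)"
proof -
  let ?r = "rat_vs.representation (natural_basis lam N) (lam j)"
  have "\<psi> (lam j) = \<psi> (\<Sum>g | ?r g \<noteq> 0. rat_scale (?r g) g)"
    using rat_vs.sum_nonzero_representation_eq[OF independent_natural_basis lam_in_span_natural_basis[OF j]] by simp
  also have "\<dots> = (\<Sum>g | ?r g \<noteq> 0. rat_scale (?r g) (\<psi> g))"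
    by (simp add: rat_vs_pair.linear_sum[OF \<psi>] rat_vs_pair.linear_scale[OF \<psi>])
  also have "\<dots> = pairing lam N j y"
    unfolding pairing_def Let_def using rat_vs.representation_ne_zero y
    by (intro sum.cong) (auto simp: rat_scale_def)
  finally show ?thesis ..
qed

lemma pairing_add: "pairing lam N j (\<lambda>g. x g + p g) = pairing lam N j x + pairing lam N j p"
  by (simp add: pairing_def Let_def distrib_left sum.distrib)

lemma common_denominator:
  fixes R :: "rat set"
  assumes "finite R"
  shows "\<exists>L::nat. L > 0 \<and> (\<forall>r\<in>R. \<exists>m::int. r * of_nat L = of_int m)"
  using assms
proof induction
  case (insert r R)
  then obtain L where L: "L > 0" "\<forall>r\<in>R. \<exists>m::int. r * of_nat L = of_int m" by blast
  obtain a b where ab: "quotient_of r = (a, b)" by fastforce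
  have b: "b > 0" "r = of_int a / of_int b" using quotient_of_denom_pos[OF ab] quotient_of_div[OF ab] by auto
  have "\<exists>m::int. r' * of_nat (L * nat b) = of_int m" if r': "r' \<in> insert r R" for r'
  proof (cases "r' = r")
    case True
    then show ?thesis using b by (intro exI[of _ "a * int L"]) (simp add: field_simps)
  next
    case False
    then obtain m where "r' * of_nat L = of_int m" using r' L(2) by blast
    then show ?thesis using b by (intro exI[of _ "m * b"]) (simp add: mult.assoc[symmetric])
  qed
  then show ?case using L(1) b(1) by (intro exI[of _ "L * nat b"]) auto
qed auto

text \<open>With a common denominator \<open>L\<close> of the coordinates, the arguments of the values of \<open>\<xi>\<close> at the elements
  \<open>g / L\<close> define a linear map that induces \<open>\<xi>\<close> on finitely many elements.\<close>

lemma character_linear_lift: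
  assumes G: "rat_vs.independent G" and F: "finite F" "F \<subseteq> rat_vs.span G"
    and \<xi>: "\<xi> \<in> real_characters" and x: "\<And>g. g \<in> G \<Longrightarrow> cis (x g) = \<xi> g"
  shows "\<exists>q\<in>period_lattice G. \<exists>\<psi>. Vector_Spaces.linear rat_scale rat_scale \<psi> \<and>
    (\<forall>g\<in>G. \<psi> g = x g + q g) \<and> (\<forall>v\<in>F. cis (\<psi> v) = \<xi> v)"
proof -
  define r where "r = rat_vs.representation G"
  have finr: "finite {g. r v g \<noteq> 0}" for v unfolding r_def by (rule rat_vs.finite_representation)
  have "finite (\<Union>v\<in>F. r v ` {g. r v g \<noteq> 0})" using F finr by auto
  then obtain L :: nat where L: "L > 0" "\<And>v g. v \<in> F \<Longrightarrow> r v g \<noteq> 0 \<Longrightarrow> \<exists>m::int. r v g * of_nat L = of_int m"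
    using common_denominator[of "\<Union>v\<in>F. r v ` {g. r v g \<noteq> 0}"] by (metis (mono_tags, lifting) UN_I imageI mem_Collect_eq)
  define \<theta> where "\<theta> g = Arg (\<xi> (g / L))" for g
  have \<theta>: "\<xi> (g / L) = cis (\<theta> g)" for g
    using cis_Arg[OF real_charactersD(7)[OF \<xi>], of "g / L"] real_charactersD(1)[OF \<xi>, of "g / L"]
    by (simp add: \<theta>_def sgn_div_norm)
  \<comment> \<open>The difference between two angles of the same number \<open>\<xi> g\<close>,
    hence a multiple of \<open>2 * pi\<close> on \<open>G\<close>.\<close>
  define q where "q g = L * \<theta> g - x g" for g
  have q: "q \<in> period_lattice G"
    unfolding period_lattice_def
  proof (intro CollectI ballI)
    fix g assume g: "g \<in> G"
    have "cis (L * \<theta> g) = \<xi> g"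
      using character_of_int_mult[OF \<xi> \<theta>, of "int L" g] L(1) by simp
    then have "cis (L * \<theta> g) = cis (x g)" using x[OF g] by simp
    then obtain n :: int where "L * \<theta> g = x g + 2 * pi * n"
      using cis_eq_imp by blast
    then show "\<exists>m::int. q g = 2 * pi * of_int m" by (auto simp: q_def)
  qed
  obtain \<psi> where \<psi>: "Vector_Spaces.linear rat_scale rat_scale \<psi>" "\<forall>g\<in>G. \<psi> g = L * \<theta> g"
    using rat_vs_pair.linear_independent_extend[OF G, of "\<lambda>g. L * \<theta> g"] by blast
  have "cis (\<psi> v) = \<xi> v" if v: "v \<in> F" for v
  proof -
    have vsum: "(\<Sum>g | r v g \<noteq> 0. rat_scale (r v g) g) = v"
      unfolding r_def using F(2) v by (intro rat_vs.sum_nonzero_representation_eq G) auto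
    \<comment> \<open>With \<open>r v g = m / L\<close> both sides are the \<open>m\<close>-th power
      of \<open>\<xi> (g / L)\<close>.\<close>
    have term_eq: "cis (rat_scale (r v g) (\<psi> g)) = \<xi> (rat_scale (r v g) g)" if g: "r v g \<noteq> 0" for g
    proof -
      have gG: "g \<in> G" using g rat_vs.representation_ne_zero unfolding r_def by blast
      obtain m :: int where "r v g * of_nat L = of_int m" using L(2)[OF v g] by blast
      then have "real_of_rat (r v g * of_nat L) = real_of_rat (of_int m)" by simp
      then have m: "real_of_rat (r v g) * real L = of_int m" by (simp add: of_rat_mult)
      have "rat_scale (r v g) (\<psi> g) = of_int m * \<theta> g"
        using \<psi>(2) gG by (simp add: rat_scale_def m[symmetric])
      moreover have "rat_scale (r v g) g = of_int m * (g / L)"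
        using L(1) by (simp add: rat_scale_def m[symmetric])
      ultimately show ?thesis using character_of_int_mult[OF \<xi> \<theta>, of m g] by simp
    qed
    have "cis (\<psi> v) = cis (\<Sum>g | r v g \<noteq> 0. rat_scale (r v g) (\<psi> g))"
      by (subst vsum[symmetric]) (simp add: rat_vs_pair.linear_sum[OF \<psi>(1)] rat_vs_pair.linear_scale[OF \<psi>(1)])
    also have "\<dots> = (\<Prod>g | r v g \<noteq> 0. cis (rat_scale (r v g) (\<psi> g)))"
      by (rule character_sum[OF cis_additive_character]) simp
    also have "\<dots> = (\<Prod>g | r v g \<noteq> 0. \<xi> (rat_scale (r v g) g))"
      by (rule prod.cong) (auto simp: term_eq)
    also have "\<dots> = \<xi> v" by (simp add: character_sum[OF \<xi>, symmetric] vsum)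
    finally show ?thesis .
  qed
  with \<psi> q show ?thesis by (intro bexI[OF _ q] exI[of _ \<psi>]) (auto simp: q_def)
qed

text \<open>A linear map inducing \<open>\<xi>\<close> on all exponents may fail to exist, but the
  definition asks for one on each finite segment only, which the lift provides.\<close>

lemma character_imp_AP_equiv:
  assumes \<xi>: "\<xi> \<in> real_characters"
    and eq: "\<And>j. j \<in> idx N \<Longrightarrow> dirichlet_coeff \<alpha> \<beta> f2 (lam j) = dirichlet_coeff \<alpha> \<beta> f1 (lam j) * \<xi> (lam j)"
  shows "AP_equiv \<alpha> \<beta> lam N f1 f2"
  unfolding AP_equiv_def
proof (intro allI impI)
  fix n assume n: "1 \<le> n" "enat n \<le> N"
  have j: "j \<in> idx N" if "j < n" for j
    using that n(2) unfolding idx_def by (metis enat_ord_simps(2) less_le_trans mem_Collect_eq)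
  have arg: "cis (Arg (\<xi> g)) = \<xi> g" for g
    using cis_Arg[OF real_charactersD(7)[OF \<xi>], of g] real_charactersD(1)[OF \<xi>, of g] by (simp add: sgn_div_norm)
  have "lam ` {..<n} \<subseteq> rat_vs.span (natural_basis lam N)"
    using j lam_in_span_natural_basis by auto
  from character_linear_lift[OF independent_natural_basis finite_imageI[OF finite_lessThan] this \<xi>, of "\<lambda>g. Arg (\<xi> g)", OF arg]
  obtain \<psi> where \<psi>: "Vector_Spaces.linear rat_scale rat_scale \<psi>" "\<forall>v\<in>lam ` {..<n}. cis (\<psi> v) = \<xi> v"
    by blast
  show "\<exists>\<psi>. rat_linear_on (rat_vs.span (lam ` {..<n})) \<psi> \<and>
        (\<forall>j<n. dirichlet_coeff \<alpha> \<beta> f2 (lam j) =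
               dirichlet_coeff \<alpha> \<beta> f1 (lam j) * exp (\<i> * of_real (\<psi> (lam j))))"
    using \<psi>(2) eq j by (intro exI[of _ \<psi>])
      (auto simp: rat_linear_on_def rat_vs_pair.linear_add[OF \<psi>(1)] rat_vs_pair.linear_scale[OF \<psi>(1)] simp flip: cis_conv_exp)
qed

text \<open>On an initial segment one vector \<open>q\<close> replaces all the \<open>p j\<close>,
  and the angles become values of the linear map equal to \<open>x + q\<close> on the basis.
  \<open>exists_character\<close>, with all \<open>a j\<close> equal to 1, merges the
  segments.\<close>

lemma coherent_imp_character:
  assumes coh: "coherent lam N p"
  shows "\<exists>\<xi>\<in>real_characters. \<forall>j\<in>idx N. cis (pairing lam N j (\<lambda>g. x g + p j g)) = \<xi> (lam j)"
proof -
  have "\<exists>\<xi>\<in>real_characters. \<forall>j\<in>idx N. cis (pairing lam N j (\<lambda>g. x g + p j g)) = 1 * \<xi> (lam j)"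
  proof (rule exists_character)
    fix n assume n: "enat n \<le> N"
    have "\<exists>q. \<forall>j<n. \<exists>m::int. pairing lam N j (p j) = pairing lam N j q + 2 * pi * of_int m"
      using coh n unfolding coherent_def by (cases "n \<ge> 1") (blast, simp)
    then obtain q where q: "\<And>j. j < n \<Longrightarrow> \<exists>m::int. pairing lam N j (p j) = pairing lam N j q + 2 * pi * of_int m"
      by blast
    obtain \<psi> where \<psi>: "Vector_Spaces.linear rat_scale rat_scale \<psi>" "\<forall>g\<in>natural_basis lam N. \<psi> g = x g + q g"
      using rat_vs_pair.linear_independent_extend[OF independent_natural_basis[of lam N], of "\<lambda>g. x g + q g"] by blast
    have "cis (pairing lam N j (\<lambda>g. x g + p j g)) = cis (\<psi> (lam j))" if j: "j < n" for j
    proof -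
      have jN: "j \<in> idx N" using j n unfolding idx_def by (metis enat_ord_simps(2) less_le_trans mem_Collect_eq)
      obtain m :: int where m: "pairing lam N j (p j) = pairing lam N j q + 2 * pi * of_int m" using q[OF j] by blast
      have "pairing lam N j (\<lambda>g. x g + p j g) = pairing lam N j (\<lambda>g. x g + q g) + 2 * pi * of_int m"
        by (simp add: pairing_add m)
      also have "pairing lam N j (\<lambda>g. x g + q g) = \<psi> (lam j)"
        using \<psi>(2) by (intro pairing_eq_linear[OF \<psi>(1) _ jN]) auto
      finally show ?thesis by (simp flip: cis_mult)
    qed
    then show "\<exists>\<xi>\<in>real_characters. \<forall>j<n. cis (pairing lam N j (\<lambda>g. x g + p j g)) = 1 * \<xi> (lam j)"
      by (intro bexI[OF _ cis_additive_character[OF rat_linear_add[OF \<psi>(1)]]]) auto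
  qed
  then show ?thesis by simp
qed

text \<open>\<open>x\<close> records the angles of \<open>\<xi>\<close> at the basis. The lift for
  the single exponent \<open>lam j\<close> gives \<open>p j\<close>; the lift for a whole initial
  segment gives the common vector in \<open>coherent\<close>.\<close>

lemma character_imp_coherent:
  assumes \<xi>: "\<xi> \<in> real_characters"
  shows "\<exists>x\<in>torus_box (natural_basis lam N). \<exists>p. (\<forall>j\<in>idx N. p j \<in> period_lattice (natural_basis lam N)) \<and>
    coherent lam N p \<and> (\<forall>j\<in>idx N. cis (pairing lam N j (\<lambda>g. x g + p j g)) = \<xi> (lam j))"
proof -
  let ?G = "natural_basis lam N"
  define x where "x g = Arg2pi (\<xi> g)" for g
  have x: "x \<in> torus_box ?G" "cis (x g) = \<xi> g" for g
    using Arg2pi_ge_0 Arg2pi_lt_2pi Arg2pi_eq[of "\<xi> g"] real_charactersD(1)[OF \<xi>, of g]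
    by (auto simp: torus_box_def x_def cis_conv_exp)
  have lift: "\<exists>q\<in>period_lattice ?G. \<forall>j\<in>J. cis (pairing lam N j (\<lambda>g. x g + q g)) = \<xi> (lam j)"
    if J: "finite J" "J \<subseteq> idx N" for J
  proof -
    have "lam ` J \<subseteq> rat_vs.span ?G" using J(2) lam_in_span_natural_basis by auto
    from character_linear_lift[OF independent_natural_basis finite_imageI[OF J(1)] this \<xi>, of x, OF x(2)]
    obtain q \<psi> where q: "q \<in> period_lattice ?G" and \<psi>: "Vector_Spaces.linear rat_scale rat_scale \<psi>"
      "\<forall>g\<in>?G. \<psi> g = x g + q g" "\<forall>v\<in>lam ` J. cis (\<psi> v) = \<xi> v"
      by blast
    have "cis (pairing lam N j (\<lambda>g. x g + q g)) = \<xi> (lam j)" if "j \<in> J" for j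
      using \<psi>(3) that J(2) pairing_eq_linear[OF \<psi>(1), of lam N "\<lambda>g. x g + q g" j] \<psi>(2) by auto
    with q show ?thesis by blast
  qed
  have "\<exists>q\<in>period_lattice ?G. cis (pairing lam N j (\<lambda>g. x g + q g)) = \<xi> (lam j)" if "j \<in> idx N" for j
    using lift[of "{j}"] that by simp
  then obtain p where p: "\<And>j. j \<in> idx N \<Longrightarrow> p j \<in> period_lattice ?G"
    "\<And>j. j \<in> idx N \<Longrightarrow> cis (pairing lam N j (\<lambda>g. x g + p j g)) = \<xi> (lam j)"
    by metis
  have "coherent lam N p"
    unfolding coherent_def
  proof (intro allI impI)
    fix n assume n: "1 \<le> n" "enat n \<le> N"
    have jN: "j \<in> idx N" if "j < n" for j
      using that n(2) unfolding idx_def by (metis enat_ord_simps(2) less_le_trans mem_Collect_eq)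
    obtain q where q: "q \<in> period_lattice ?G" "\<And>j. j < n \<Longrightarrow> cis (pairing lam N j (\<lambda>g. x g + q g)) = \<xi> (lam j)"
      using lift[of "{..<n}"] jN by auto
    \<comment> \<open>Both lattice vectors complete the same \<open>x\<close> to an angle of
      \<open>\<xi> (lam j)\<close>, so their pairings differ by a multiple of
      \<open>2 * pi\<close>.\<close>
    have "\<exists>m::int. pairing lam N j (p j) = pairing lam N j q + 2 * pi * of_int m" if j: "j < n" for j
    proof -
      have "cis (pairing lam N j x + pairing lam N j (p j)) = cis (pairing lam N j x + pairing lam N j q)"
        using p(2)[OF jN[OF j]] q(2)[OF j] by (simp add: pairing_add)
      then obtain m :: int where "pairing lam N j x + pairing lam N j (p j) = pairing lam N j x + pairing lam N j q + 2 * pi * m"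
        using cis_eq_imp by blast
      then show ?thesis by auto
    qed
    with q(1) show "\<exists>q\<in>period_lattice ?G. \<forall>j<n. \<exists>m::int. pairing lam N j (p j) = pairing lam N j q + 2 * pi * of_int m"
      by blast
  qed
  with x(1) p show ?thesis by blast
qed

section \<open>Twisting by characters\<close>

lemma finite_support_character_mult:
  fixes c :: "real \<Rightarrow> complex"
  assumes "\<xi> \<in> real_characters" "finite {\<nu>. c \<nu> \<noteq> 0}"
  shows "finite {\<nu>. \<xi> \<nu> * c \<nu> \<noteq> 0}"
  using assms by (simp add: real_charactersD(7))

text \<open>Three steps: from \<open>f\<close> to a polynomial on the line, by Kronecker to the
  twisted polynomial at \<open>s\<close>, and from there to \<open>h s\<close>.\<close>

lemma closure_Img_line_twist:
  assumes c: "ap_limit \<alpha> \<beta> c f" and h: "ap_limit \<alpha> \<beta> (\<lambda>k \<nu>. \<xi> \<nu> * c k \<nu>) h"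
    and \<xi>: "\<xi> \<in> real_characters" and s: "s \<in> vstrip \<alpha> \<beta>"
  shows "h s \<in> closure (Img_line f (Re s))"
  unfolding closure_approachable
proof (intro allI impI)
  fix e :: real assume e: "e > 0"
  have \<sigma>: "\<alpha> < ereal (Re s)" "ereal (Re s) < \<beta>" using s by (auto simp: vstrip_def)
  have "\<forall>\<^sub>F k in sequentially. (\<forall>t\<in>UNIV. dist (epoly (c k) (Complex (Re s) t)) (f (Complex (Re s) t)) < e / 3)
      \<and> dist (epoly (\<lambda>\<nu>. \<xi> \<nu> * c k \<nu>) s) (h s) < e / 3"
    using uniform_limitD[OF ap_limit_line[OF c \<sigma>], of "e / 3"] tendstoD[OF ap_limit_pointwise[OF h s], of "e / 3"] e
    by (intro eventually_conj) auto
  then obtain k where k: "\<And>t. dist (epoly (c k) (Complex (Re s) t)) (f (Complex (Re s) t)) < e / 3"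
    "dist (epoly (\<lambda>\<nu>. \<xi> \<nu> * c k \<nu>) s) (h s) < e / 3"
    using eventually_happens'[OF sequentially_bot] by fast
  have "finite {\<nu>. c k \<nu> \<noteq> 0}" using c by (simp add: ap_limit_def)
  from epoly_kronecker[OF this \<xi>, of "e / 3" "Re s" "Im s"] e obtain u where
    "dist (epoly (c k) (Complex (Re s) u)) (epoly (\<lambda>\<nu>. \<xi> \<nu> * c k \<nu>) s) < e / 3"
    by (auto simp: dist_norm)
  then have "dist (f (Complex (Re s) u)) (h s) < e" using k(1)[of u] k(2) by metric
  then show "\<exists>y\<in>Img_line f (Re s). dist y (h s) < e" unfolding Img_line_def by blast
qed

text \<open>Twists do not increase suprema along lines, so the twisted approximants are Cauchy
  uniformly in the point and in the character jointly. Uniformity in the point gives the limit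
  function; uniformity in the character makes its values continuous in \<open>\<xi>\<close>, since a
  polynomial involves only finitely many values of \<open>\<xi>\<close>.\<close>

lemma ap_limit_twist:
  assumes c: "ap_limit \<alpha> \<beta> c f"
  shows "\<exists>\<Phi>. (\<forall>\<xi>\<in>real_characters. ap_limit \<alpha> \<beta> (\<lambda>k \<nu>. \<xi> \<nu> * c k \<nu>) (\<Phi> \<xi>)) \<and>
    (\<forall>s\<in>vstrip \<alpha> \<beta>. continuous_on real_characters (\<lambda>\<xi>. \<Phi> \<xi> s))"
proof -
  define P where "P k \<xi> = epoly (\<lambda>\<nu>. \<xi> \<nu> * c k \<nu>)" for k \<xi>
  define \<Phi> where "\<Phi> \<xi> s = lim (\<lambda>k. P k \<xi> s)" for \<xi> s
  have fin: "finite {\<nu>. c k \<nu> \<noteq> 0}" for k using c by (simp add: ap_limit_def)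
  have unif: "uniform_limit (real_characters \<times> closed_vstrip \<alpha>1 \<beta>1) (\<lambda>k (\<xi>, s). P k \<xi> s) (\<lambda>(\<xi>, s). \<Phi> \<xi> s) sequentially"
    if ab1: "\<alpha> < ereal \<alpha>1" "\<alpha>1 < \<beta>1" "ereal \<beta>1 < \<beta>" for \<alpha>1 \<beta>1
  proof -
    have ul: "uniform_limit (closed_vstrip \<alpha>1 \<beta>1) (\<lambda>k. epoly (c k)) f sequentially"
      using c ab1 by (simp add: ap_limit_def)
    have "uniformly_Cauchy_on (real_characters \<times> closed_vstrip \<alpha>1 \<beta>1) (\<lambda>k (\<xi>, s). P k \<xi> s)"
    proof (rule uniformly_Cauchy_onI)
      fix e :: real assume e: "e > 0"
      then obtain K where K: "\<And>k s. k \<ge> K \<Longrightarrow> s \<in> closed_vstrip \<alpha>1 \<beta>1 \<Longrightarrow> dist (epoly (c k) s) (f s) < e / 4"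
        using uniform_limitD[OF ul, of "e / 4"] by (auto simp: eventually_sequentially)
      have "dist (P k \<xi> s) (P m \<xi> s) < e"
        if "k \<ge> K" "m \<ge> K" and \<xi>: "\<xi> \<in> real_characters" and s: "s \<in> closed_vstrip \<alpha>1 \<beta>1" for k m \<xi> s
      proof -
        \<comment> \<open>The bound for twists needs the whole vertical line through
          \<open>s\<close>, which stays in the reduced strip.\<close>
        have "cmod (epoly (\<lambda>\<nu>. c k \<nu> - c m \<nu>) (Complex (Re s) t)) \<le> e / 2" for t
        proof -
          have "Complex (Re s) t \<in> closed_vstrip \<alpha>1 \<beta>1" using s by (simp add: closed_vstrip_def)
          from K[OF that(1) this] K[OF that(2) this] show ?thesis
            unfolding epoly_diff[OF fin fin] dist_norm[symmetric] by metric
        qed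
        from epoly_character_bound[OF finite_support_diff[OF fin fin] \<xi> this, of "Im s"]
        have "cmod (P k \<xi> s - P m \<xi> s) \<le> e / 2"
          unfolding P_def
          by (simp add: right_diff_distrib epoly_diff[OF finite_support_character_mult[OF \<xi> fin] finite_support_character_mult[OF \<xi> fin]])
        then show ?thesis using e by (simp add: dist_norm)
      qed
      then show "\<exists>M. \<forall>x\<in>real_characters \<times> closed_vstrip \<alpha>1 \<beta>1. \<forall>m\<ge>M. \<forall>n\<ge>M.
          dist (case x of (\<xi>, s) \<Rightarrow> P m \<xi> s) (case x of (\<xi>, s) \<Rightarrow> P n \<xi> s) < e"
        by (intro exI[of _ K]) auto
    qed
    then have "uniformly_convergent_on (real_characters \<times> closed_vstrip \<alpha>1 \<beta>1) (\<lambda>k (\<xi>, s). P k \<xi> s)"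
      by (rule Cauchy_uniformly_convergent)
    then show ?thesis
      unfolding uniformly_convergent_uniform_limit_iff by (simp add: \<Phi>_def case_prod_unfold)
  qed
  have "ap_limit \<alpha> \<beta> (\<lambda>k \<nu>. \<xi> \<nu> * c k \<nu>) (\<Phi> \<xi>)" if \<xi>: "\<xi> \<in> real_characters" for \<xi>
    unfolding ap_limit_def
  proof (intro conjI allI impI finite_support_character_mult \<xi> fin)
    fix \<alpha>1 \<beta>1 assume "\<alpha> < ereal \<alpha>1" "\<alpha>1 < \<beta>1" "ereal \<beta>1 < \<beta>"
    from uniform_limit_compose'[OF unif[OF this], where h = "\<lambda>s. (\<xi>, s)" and B = "closed_vstrip \<alpha>1 \<beta>1"]
    show "uniform_limit (closed_vstrip \<alpha>1 \<beta>1) (\<lambda>k. epoly (\<lambda>\<nu>. \<xi> \<nu> * c k \<nu>)) (\<Phi> \<xi>) sequentially"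
      using \<xi> by (simp add: P_def)
  qed
  moreover have "continuous_on real_characters (\<lambda>\<xi>. \<Phi> \<xi> s)" if s: "s \<in> vstrip \<alpha> \<beta>" for s
  proof (rule uniform_limit_theorem)
    have \<sigma>: "\<alpha> < ereal (Re s)" "ereal (Re s) < \<beta>" using s by (auto simp: vstrip_def)
    obtain \<alpha>1 \<beta>1 where ab1: "\<alpha> < ereal \<alpha>1" "\<alpha>1 < Re s" "Re s < \<beta>1" "ereal \<beta>1 < \<beta>"
      by (rule reduced_strip_exists[OF \<sigma>])
    have "\<alpha>1 < \<beta>1" using ab1 by simp
    from uniform_limit_compose'[OF unif[OF ab1(1) this ab1(4)], where h = "\<lambda>\<xi>. (\<xi>, s)" and B = real_characters]
    show "uniform_limit real_characters (\<lambda>k \<xi>. P k \<xi> s) (\<lambda>\<xi>. \<Phi> \<xi> s) sequentially"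
      using ab1 by (simp add: closed_vstrip_def)
    have "P k \<xi> s = (\<Sum>\<nu> | c k \<nu> \<noteq> 0. \<xi> \<nu> * c k \<nu> * exp (of_real \<nu> * s))" for k \<xi>
      unfolding P_def by (rule epoly_superset[OF fin]) auto
    moreover have "continuous_on real_characters (\<lambda>\<xi>. \<Sum>\<nu> | c k \<nu> \<noteq> 0. \<xi> \<nu> * c k \<nu> * exp (of_real \<nu> * s))" for k
      by (intro continuous_on_sum continuous_on_mult continuous_on_const continuous_on_subset[OF continuous_on_product_coordinates]) auto
    ultimately show "\<forall>\<^sub>F k in sequentially. continuous_on real_characters (\<lambda>\<xi>. P k \<xi> s)"
      by simp
  qed simp
  ultimately show ?thesis by (intro exI[of _ \<Phi>]) auto
qed

text \<open>Twisting the Bochner-Fejer polynomials, rather than arbitrary approximants, keeps the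
  coefficients explicit: factor times \<open>\<xi> \<nu>\<close> times the coefficient of
  \<open>f\<close>. A twist by \<open>cis (\<nu> * t)\<close> moves every polynomial up by
  \<open>t\<close>.\<close>

lemma AP_twist:
  fixes lam :: "nat \<Rightarrow> real"
  assumes ab: "\<alpha> < \<beta>" and f: "f \<in> AP \<alpha> \<beta>"
    and supp: "\<And>\<nu>. \<nu> \<notin> range lam \<Longrightarrow> dirichlet_coeff \<alpha> \<beta> f \<nu> = 0"
  shows "\<exists>\<Phi>. (\<forall>\<xi>\<in>real_characters. \<Phi> \<xi> \<in> AP \<alpha> \<beta> \<and>
      (\<forall>\<nu>. dirichlet_coeff \<alpha> \<beta> (\<Phi> \<xi>) \<nu> = \<xi> \<nu> * dirichlet_coeff \<alpha> \<beta> f \<nu>) \<and>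
      (\<forall>s\<in>vstrip \<alpha> \<beta>. \<Phi> \<xi> s \<in> closure (Img_line f (Re s)))) \<and>
    (\<forall>s\<in>vstrip \<alpha> \<beta>. continuous_on real_characters (\<lambda>\<xi>. \<Phi> \<xi> s)) \<and>
    (\<forall>\<sigma> t. \<alpha> < ereal \<sigma> \<longrightarrow> ereal \<sigma> < \<beta> \<longrightarrow> \<Phi> (\<lambda>\<nu>. cis (\<nu> * t)) (of_real \<sigma>) = f (Complex \<sigma> t))"
proof -
  obtain \<kappa> :: "nat \<Rightarrow> real \<Rightarrow> real" where \<kappa>: "\<And>j. (\<lambda>k. \<kappa> k (lam j)) \<longlonglongrightarrow> 1"
    and lim: "ap_limit \<alpha> \<beta> (\<lambda>k \<nu>. of_real (\<kappa> k \<nu>) * dirichlet_coeff \<alpha> \<beta> f \<nu>) f"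
    using bochner_fejer_approximation[OF ab f, of lam] by blast
  let ?c = "\<lambda>k \<nu>. of_real (\<kappa> k \<nu>) * dirichlet_coeff \<alpha> \<beta> f \<nu>"
  obtain \<Phi> where \<Phi>: "\<And>\<xi>. \<xi> \<in> real_characters \<Longrightarrow> ap_limit \<alpha> \<beta> (\<lambda>k \<nu>. \<xi> \<nu> * ?c k \<nu>) (\<Phi> \<xi>)"
    and cont: "\<And>s. s \<in> vstrip \<alpha> \<beta> \<Longrightarrow> continuous_on real_characters (\<lambda>\<xi>. \<Phi> \<xi> s)"
    using ap_limit_twist[OF lim] by blast
  show ?thesis
  proof (rule exI[of _ \<Phi>], intro conjI ballI allI impI cont)
    fix \<xi> assume \<xi>: "\<xi> \<in> real_characters"
    show "\<Phi> \<xi> \<in> AP \<alpha> \<beta>" by (rule ap_limit_imp_AP[OF \<Phi>[OF \<xi>]])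
    show "\<Phi> \<xi> s \<in> closure (Img_line f (Re s))" if "s \<in> vstrip \<alpha> \<beta>" for s
      by (rule closure_Img_line_twist[OF lim \<Phi>[OF \<xi>] \<xi> that])
    show "dirichlet_coeff \<alpha> \<beta> (\<Phi> \<xi>) \<nu> = \<xi> \<nu> * dirichlet_coeff \<alpha> \<beta> f \<nu>" for \<nu>
    proof -
      have "(\<lambda>k. \<xi> \<nu> * ?c k \<nu>) \<longlonglongrightarrow> \<xi> \<nu> * dirichlet_coeff \<alpha> \<beta> f \<nu>"
      \<comment> \<open>The factors are known to tend to 1 on \<open>range lam\<close> only;
        elsewhere the coefficient of \<open>f\<close> is zero.\<close>
      proof (cases "\<nu> \<in> range lam")
        case True
        then have "(\<lambda>k. complex_of_real (\<kappa> k \<nu>)) \<longlonglongrightarrow> 1" using \<kappa> tendsto_of_real[of "\<lambda>k. \<kappa> k \<nu>" 1] by auto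
        from tendsto_mult[OF tendsto_const tendsto_mult[OF this tendsto_const]] show ?thesis by simp
      qed (simp add: supp)
      then show ?thesis using ap_limit_coeff[OF ab \<Phi>[OF \<xi>]] LIMSEQ_unique by blast
    qed
  next
    fix \<sigma> t assume \<sigma>: "\<alpha> < ereal \<sigma>" "ereal \<sigma> < \<beta>"
    have ch: "(\<lambda>\<nu>. cis (\<nu> * t)) \<in> real_characters"
      by (rule cis_additive_character) (simp add: distrib_right)
    have fin: "finite {\<nu>. ?c k \<nu> \<noteq> 0}" for k using lim unfolding ap_limit_def by blast
    have "epoly (\<lambda>\<nu>. cis (\<nu> * t) * ?c k \<nu>) (of_real \<sigma>) = epoly (?c k) (Complex \<sigma> t)" for k
    proof -
      have "exp (of_real \<nu> * Complex \<sigma> t) = exp (of_real \<nu> * of_real \<sigma>) * cis (\<nu> * t)" for \<nu>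
        using exp_vertical_shift[of \<nu> \<sigma> 0 t] by (simp add: complex_of_real_def)
      then show ?thesis by (subst (1 2) epoly_superset[OF fin]) (auto simp: mult_ac)
    qed
    moreover have "(\<lambda>k. epoly (\<lambda>\<nu>. cis (\<nu> * t) * ?c k \<nu>) (of_real \<sigma>)) \<longlonglongrightarrow> \<Phi> (\<lambda>\<nu>. cis (\<nu> * t)) (of_real \<sigma>)"
      by (rule ap_limit_pointwise[OF \<Phi>[OF ch]]) (simp add: vstrip_def \<sigma>)
    moreover have "(\<lambda>k. epoly (?c k) (Complex \<sigma> t)) \<longlonglongrightarrow> f (Complex \<sigma> t)"
      by (rule ap_limit_pointwise[OF lim]) (simp add: vstrip_def \<sigma>)
    ultimately show "\<Phi> (\<lambda>\<nu>. cis (\<nu> * t)) (of_real \<sigma>) = f (Complex \<sigma> t)"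
      using LIMSEQ_unique by auto
  qed
qed

text \<open>Whatever the factors, the coefficients of the finite sums converge to those of
  \<open>h\<close>, so the limit function has the Dirichlet series of \<open>h\<close> and agrees
  with it. Folner kernels supply one admissible choice of factors.\<close>

lemma has_bochner_fejer_sum_iff:
  assumes ab: "\<alpha> < \<beta>" and inj: "inj_on lam (idx N)" and h: "h \<in> DirichletAP \<alpha> \<beta> (lam ` idx N)"
    and b: "\<And>j. j \<in> idx N \<Longrightarrow> dirichlet_coeff \<alpha> \<beta> h (lam j) = b j" and s: "s \<in> vstrip \<alpha> \<beta>"
  shows "has_bochner_fejer_sum \<alpha> \<beta> lam N b s w \<longleftrightarrow> w = h s"
proof -
  have hAP: "h \<in> AP \<alpha> \<beta>" and h0: "\<And>\<nu>. \<nu> \<notin> lam ` idx N \<Longrightarrow> dirichlet_coeff \<alpha> \<beta> h \<nu> = 0"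
    using h by (auto simp: DirichletAP_def)
  \<comment> \<open>Passes from sums over indices to sums over frequencies; injectivity of
    \<open>lam\<close> prevents terms from merging.\<close>
  have sum_eq: "(\<Sum>j | j \<in> idx N \<and> q j \<noteq> 0. of_real (q j) * b j * exp (of_real (lam j) * z)) = epoly d z"
    if fin: "finite {j \<in> idx N. q j \<noteq> 0}" and dlam: "\<And>j. j \<in> idx N \<Longrightarrow> d (lam j) = of_real (q j) * b j"
      and d0: "\<And>\<nu>. \<nu> \<notin> lam ` idx N \<Longrightarrow> d \<nu> = 0" for q :: "nat \<Rightarrow> real" and d z
  proof -
    have inj': "inj_on lam {j \<in> idx N. q j \<noteq> 0}" using inj by (rule inj_on_subset) auto
    have supp: "\<nu> \<in> lam ` {j \<in> idx N. q j \<noteq> 0}" if nz: "d \<nu> \<noteq> 0" for \<nu>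
    proof -
      have "\<nu> \<in> lam ` idx N" by (rule ccontr) (use d0[of \<nu>] nz in simp)
      then obtain j where "j \<in> idx N" "\<nu> = lam j" by (rule imageE)
      with nz dlam[of j] show ?thesis by auto
    qed
    have "epoly d z = (\<Sum>\<nu>\<in>lam ` {j \<in> idx N. q j \<noteq> 0}. d \<nu> * exp (of_real \<nu> * z))"
      by (rule epoly_superset[OF finite_imageI[OF fin] supp])
    also have "\<dots> = (\<Sum>j\<in>{j \<in> idx N. q j \<noteq> 0}. d (lam j) * exp (of_real (lam j) * z))"
      by (simp add: sum.reindex[OF inj'])
    also have "\<dots> = (\<Sum>j\<in>{j \<in> idx N. q j \<noteq> 0}. of_real (q j) * b j * exp (of_real (lam j) * z))"
      by (rule sum.cong) (auto simp: dlam)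
    finally show ?thesis by simp
  qed
  show ?thesis
  proof
    assume "has_bochner_fejer_sum \<alpha> \<beta> lam N b s w"
    then obtain q :: "nat \<Rightarrow> nat \<Rightarrow> real" and g where q: "\<And>k. finite {j \<in> idx N. q k j \<noteq> 0}"
      "\<And>j. j \<in> idx N \<Longrightarrow> (\<lambda>k. q k j) \<longlonglongrightarrow> 1"
      "\<And>\<alpha>1 \<beta>1. \<alpha> < ereal \<alpha>1 \<Longrightarrow> \<alpha>1 < \<beta>1 \<Longrightarrow> ereal \<beta>1 < \<beta> \<Longrightarrow>
           uniform_limit (closed_vstrip \<alpha>1 \<beta>1)
             (\<lambda>k z. \<Sum>j | j \<in> idx N \<and> q k j \<noteq> 0. of_real (q k j) * b j * exp (of_real (lam j) * z))
             g sequentially" "g s = w"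
      unfolding has_bochner_fejer_sum_def by blast
    define d where "d k \<nu> = (if \<nu> \<in> lam ` idx N
      then of_real (q k (the_inv_into (idx N) lam \<nu>)) * b (the_inv_into (idx N) lam \<nu>) else 0)" for k \<nu>
    have d: "d k (lam j) = of_real (q k j) * b j" if "j \<in> idx N" for k j
      using that by (simp add: d_def the_inv_into_f_f[OF inj])
    have d0: "d k \<nu> = 0" if "\<nu> \<notin> lam ` idx N" for k \<nu> using that by (simp add: d_def)
    have fin: "finite {\<nu>. d k \<nu> \<noteq> 0}" for k
    proof (rule finite_subset[OF _ finite_imageI[OF q(1)[of k], of lam]], rule subsetI)
      fix \<nu> assume \<nu>: "\<nu> \<in> {\<nu>. d k \<nu> \<noteq> 0}"
      then obtain j where "j \<in> idx N" "\<nu> = lam j" using d0 by blast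
      with \<nu> d show "\<nu> \<in> lam ` {j \<in> idx N. q k j \<noteq> 0}" by auto
    qed
    have lim: "ap_limit \<alpha> \<beta> d g"
    proof -
      have "(\<lambda>z. \<Sum>j | j \<in> idx N \<and> q k j \<noteq> 0. of_real (q k j) * b j * exp (of_real (lam j) * z)) = epoly (d k)" for k
        by (rule ext, rule sum_eq[OF q(1) d d0])
      with q(3) show ?thesis unfolding ap_limit_def by (simp add: fin)
    qed
    have "dirichlet_coeff \<alpha> \<beta> g \<nu> = dirichlet_coeff \<alpha> \<beta> h \<nu>" for \<nu>
    proof (rule LIMSEQ_unique[OF ap_limit_coeff[OF ab lim]])
      show "(\<lambda>k. d k \<nu>) \<longlonglongrightarrow> dirichlet_coeff \<alpha> \<beta> h \<nu>"
      proof (cases "\<nu> \<in> lam ` idx N")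
        case True
        then obtain j where j: "j \<in> idx N" "\<nu> = lam j" by blast
        from tendsto_mult[OF tendsto_of_real[OF q(2)[OF j(1)]] tendsto_const, of "b j"]
        show ?thesis unfolding j(2) d[OF j(1)] b[OF j(1)] by simp
      qed (simp add: d0 h0)
    qed
    from AP_eqI[OF ab ap_limit_imp_AP[OF lim] hAP this s] show "w = h s" unfolding q(4) .
  next
    assume w: "w = h s"
    obtain \<kappa> :: "nat \<Rightarrow> real \<Rightarrow> real" where \<kappa>: "\<And>k. finite {\<nu>. \<kappa> k \<nu> \<noteq> 0}" "\<And>j. (\<lambda>k. \<kappa> k (lam j)) \<longlonglongrightarrow> 1"
      and lim: "ap_limit \<alpha> \<beta> (\<lambda>k \<nu>. of_real (\<kappa> k \<nu>) * dirichlet_coeff \<alpha> \<beta> h \<nu>) h"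
      using bochner_fejer_approximation[OF ab hAP, of lam] by blast
    have fin: "finite {j \<in> idx N. \<kappa> k (lam j) \<noteq> 0}" for k
    proof (rule finite_imageD)
      show "finite (lam ` {j \<in> idx N. \<kappa> k (lam j) \<noteq> 0})" by (rule finite_subset[OF _ \<kappa>(1)[of k]]) auto
      show "inj_on lam {j \<in> idx N. \<kappa> k (lam j) \<noteq> 0}" using inj by (rule inj_on_subset) auto
    qed
    have eq: "(\<lambda>z. \<Sum>j | j \<in> idx N \<and> \<kappa> k (lam j) \<noteq> 0. of_real (\<kappa> k (lam j)) * b j * exp (of_real (lam j) * z))
      = epoly (\<lambda>\<nu>. of_real (\<kappa> k \<nu>) * dirichlet_coeff \<alpha> \<beta> h \<nu>)" for k
      by (rule ext, rule sum_eq[OF fin]) (simp_all add: b h0)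
    show "has_bochner_fejer_sum \<alpha> \<beta> lam N b s w"
      unfolding has_bochner_fejer_sum_def
      by (rule exI[of _ "\<lambda>k j. \<kappa> k (lam j)"], rule exI[of _ h])
        (use fin \<kappa>(2) lim w in \<open>auto simp: eq ap_limit_def\<close>)
  qed
qed

text \<open>\<open>AP_equiv\<close> has the factors carrying \<open>g\<close> to \<open>f\<close>,
  the right side those carrying \<open>f\<close> to \<open>g\<close>; hence the conjugate character
  in both directions. Off the exponents both coefficients are zero.\<close>

lemma AP_equiv_iff_character:
  assumes f: "f \<in> DirichletAP \<alpha> \<beta> (lam ` idx N)" and g: "g \<in> DirichletAP \<alpha> \<beta> (lam ` idx N)"
  shows "AP_equiv \<alpha> \<beta> lam N g f \<longleftrightarrow>
    (\<exists>\<xi>\<in>real_characters. \<forall>\<nu>. dirichlet_coeff \<alpha> \<beta> g \<nu> = \<xi> \<nu> * dirichlet_coeff \<alpha> \<beta> f \<nu>)"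
proof
  assume "AP_equiv \<alpha> \<beta> lam N g f"
  then obtain \<xi> where \<xi>: "\<xi> \<in> real_characters"
    and eq: "\<And>j. j \<in> idx N \<Longrightarrow> dirichlet_coeff \<alpha> \<beta> f (lam j) = dirichlet_coeff \<alpha> \<beta> g (lam j) * \<xi> (lam j)"
    using AP_equiv_imp_character by blast
  have "dirichlet_coeff \<alpha> \<beta> g \<nu> = cnj (\<xi> \<nu>) * dirichlet_coeff \<alpha> \<beta> f \<nu>" for \<nu>
  proof (cases "\<nu> \<in> lam ` idx N")
    case True
    then show ?thesis using eq real_charactersD(5)[OF \<xi>, of \<nu>] by (auto simp: mult_ac)
  next
    case False then show ?thesis using f g by (simp add: DirichletAP_def)
  qed
  then show "\<exists>\<xi>\<in>real_characters. \<forall>\<nu>. dirichlet_coeff \<alpha> \<beta> g \<nu> = \<xi> \<nu> * dirichlet_coeff \<alpha> \<beta> f \<nu>"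
    using character_cnj[OF \<xi>] by (intro bexI[of _ "\<lambda>\<nu>. cnj (\<xi> \<nu>)"]) auto
next
  assume "\<exists>\<xi>\<in>real_characters. \<forall>\<nu>. dirichlet_coeff \<alpha> \<beta> g \<nu> = \<xi> \<nu> * dirichlet_coeff \<alpha> \<beta> f \<nu>"
  then obtain \<xi> where \<xi>: "\<xi> \<in> real_characters"
    and eq: "\<And>\<nu>. dirichlet_coeff \<alpha> \<beta> g \<nu> = \<xi> \<nu> * dirichlet_coeff \<alpha> \<beta> f \<nu>" by blast
  show "AP_equiv \<alpha> \<beta> lam N g f"
  proof (rule character_imp_AP_equiv[OF character_cnj[OF \<xi>]])
    fix j
    have "\<xi> (lam j) * dirichlet_coeff \<alpha> \<beta> f (lam j) * cnj (\<xi> (lam j))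
        = (\<xi> (lam j) * cnj (\<xi> (lam j))) * dirichlet_coeff \<alpha> \<beta> f (lam j)" by (simp only: mult_ac)
    then show "dirichlet_coeff \<alpha> \<beta> f (lam j) = dirichlet_coeff \<alpha> \<beta> g (lam j) * cnj (\<xi> (lam j))"
      by (simp add: eq real_charactersD(5)[OF \<xi>])
  qed
qed

theorem proposition4:
  fixes \<Lambda> :: "real set" and lam :: "nat \<Rightarrow> real" and N :: enat
    and \<alpha> \<beta> :: ereal and f :: "complex \<Rightarrow> complex" and s0 :: complex and \<sigma>0 :: real
  assumes "bij_betw lam (idx N) \<Lambda>"
    and "\<alpha> < \<beta>"
    and "f \<in> DirichletAP \<alpha> \<beta> \<Lambda>"
    and "s0 \<in> vstrip \<alpha> \<beta>"
    and "\<sigma>0 = Re s0"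
  shows "(\<forall>f1\<in>DirichletAP \<alpha> \<beta> \<Lambda>. AP_equiv \<alpha> \<beta> lam N f1 f \<longrightarrow>
            Img_line f1 \<sigma>0 \<subseteq> closure (Img_line f \<sigma>0) \<and>
            closure (Img_line f \<sigma>0) = closure (Img_line f1 \<sigma>0)) \<and>
         Img_F \<alpha> \<beta> lam N f \<sigma>0 =
            (\<Union>fk\<in>{fk \<in> DirichletAP \<alpha> \<beta> \<Lambda>. AP_equiv \<alpha> \<beta> lam N fk f}. Img_line fk \<sigma>0) \<and>
         closed (Img_F \<alpha> \<beta> lam N f \<sigma>0) \<and>
         (\<forall>f1\<in>DirichletAP \<alpha> \<beta> \<Lambda>. AP_equiv \<alpha> \<beta> lam N f1 f \<longrightarrow>
            Img_F \<alpha> \<beta> lam N f \<sigma>0 = closure (Img_line f1 \<sigma>0))"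
proof -
  have inj: "inj_on lam (idx N)" and \<Lambda>: "\<Lambda> = lam ` idx N"
    using assms(1) by (auto simp: bij_betw_def)
  note ab = assms(2)
  have \<sigma>: "\<alpha> < ereal \<sigma>0" "ereal \<sigma>0 < \<beta>" using assms(4,5) by (auto simp: vstrip_def)
  then have s: "of_real \<sigma>0 \<in> vstrip \<alpha> \<beta>" by (simp add: vstrip_def)
  let ?D = "DirichletAP \<alpha> \<beta> \<Lambda>"
  let ?a = "dirichlet_coeff \<alpha> \<beta>"
  have D: "g \<in> AP \<alpha> \<beta>" "\<nu> \<notin> range lam \<Longrightarrow> ?a g \<nu> = 0" if "g \<in> ?D" for g \<nu>
    using that by (auto simp: DirichletAP_def \<Lambda>)
  have trans: "(\<lambda>\<nu>. cis (\<nu> * t)) \<in> real_characters" for t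
    by (rule cis_additive_character) (simp add: distrib_right)
  \<comment> \<open>Stated for every \<open>g\<close>, because the equality of closures in i) uses
    it for \<open>f\<close> and for \<open>f1\<close>.\<close>
  have closures: "closure (Img_line g \<sigma>0) =
      (\<Union>fk\<in>{fk \<in> ?D. AP_equiv \<alpha> \<beta> lam N fk g}. Img_line fk \<sigma>0) \<and>
      Img_F \<alpha> \<beta> lam N g \<sigma>0 = closure (Img_line g \<sigma>0)" if g: "g \<in> ?D" for g
  proof -
    obtain \<Phi> where \<Phi>: "\<And>\<xi>. \<xi> \<in> real_characters \<Longrightarrow> \<Phi> \<xi> \<in> AP \<alpha> \<beta>"
      "\<And>\<xi> \<nu>. \<xi> \<in> real_characters \<Longrightarrow> ?a (\<Phi> \<xi>) \<nu> = \<xi> \<nu> * ?a g \<nu>"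
      "\<And>\<xi> s. \<xi> \<in> real_characters \<Longrightarrow> s \<in> vstrip \<alpha> \<beta> \<Longrightarrow> \<Phi> \<xi> s \<in> closure (Img_line g (Re s))"
      "\<And>s. s \<in> vstrip \<alpha> \<beta> \<Longrightarrow> continuous_on real_characters (\<lambda>\<xi>. \<Phi> \<xi> s)"
      "\<And>\<sigma> t. \<alpha> < ereal \<sigma> \<Longrightarrow> ereal \<sigma> < \<beta> \<Longrightarrow> \<Phi> (\<lambda>\<nu>. cis (\<nu> * t)) (of_real \<sigma>) = g (Complex \<sigma> t)"
      using AP_twist[where lam = lam, OF ab D(1)[OF g] D(2)[OF g]] by blast
    define I where "I = (\<lambda>\<xi>. \<Phi> \<xi> (of_real \<sigma>0)) ` real_characters"
    have \<Phi>D: "\<Phi> \<xi> \<in> ?D" if "\<xi> \<in> real_characters" for \<xi>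
      using \<Phi>(1,2)[OF that] g by (simp add: DirichletAP_def)
    have equiv: "AP_equiv \<alpha> \<beta> lam N h g \<longleftrightarrow> (\<exists>\<xi>\<in>real_characters. \<forall>\<nu>. ?a h \<nu> = \<xi> \<nu> * ?a g \<nu>)"
      if "h \<in> ?D" for h
      using AP_equiv_iff_character g that unfolding \<Lambda> by blast
    have "closure (Img_line g \<sigma>0) = I"
    proof
      \<comment> \<open>As a continuous image of the compact character group, \<open>I\<close> is
        closed. It contains the line of \<open>g\<close> through the translation characters, hence
        also the closure of that line.\<close>
      have "compact I" unfolding I_def
        by (rule compact_continuous_image[OF \<Phi>(4)[OF s] compact_real_characters])
      moreover have "Img_line g \<sigma>0 \<subseteq> I"
      proof (clarsimp simp: Img_line_def)
        fix t
        show "g (Complex \<sigma>0 t) \<in> I"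
          unfolding I_def by (rule image_eqI[OF _ trans[of t]]) (simp add: \<Phi>(5)[OF \<sigma>])
      qed
      ultimately show "closure (Img_line g \<sigma>0) \<subseteq> I"
        by (intro closure_minimal compact_imp_closed)
      show "I \<subseteq> closure (Img_line g \<sigma>0)" unfolding I_def using \<Phi>(3)[OF _ s] by auto
    qed
    moreover have "I = (\<Union>fk\<in>{fk \<in> ?D. AP_equiv \<alpha> \<beta> lam N fk g}. Img_line fk \<sigma>0)"
    proof (intro equalityI subsetI)
      fix w assume "w \<in> I"
      then obtain \<xi> where \<xi>: "\<xi> \<in> real_characters" "w = \<Phi> \<xi> (Complex \<sigma>0 0)"
        by (auto simp: I_def complex_of_real_def)
      then have "w \<in> Img_line (\<Phi> \<xi>) \<sigma>0" unfolding Img_line_def by blast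
      moreover have "AP_equiv \<alpha> \<beta> lam N (\<Phi> \<xi>) g" using equiv[OF \<Phi>D] \<Phi>(2) \<xi>(1) by blast
      ultimately show "w \<in> (\<Union>fk\<in>{fk \<in> ?D. AP_equiv \<alpha> \<beta> lam N fk g}. Img_line fk \<sigma>0)"
        using \<Phi>D[OF \<xi>(1)] by blast
    next
      fix w assume "w \<in> (\<Union>fk\<in>{fk \<in> ?D. AP_equiv \<alpha> \<beta> lam N fk g}. Img_line fk \<sigma>0)"
      then obtain h t where h: "h \<in> ?D" "AP_equiv \<alpha> \<beta> lam N h g" and w: "w = h (Complex \<sigma>0 t)"
        by (auto simp: Img_line_def)
      obtain \<xi> where \<xi>: "\<xi> \<in> real_characters" "\<And>\<nu>. ?a h \<nu> = \<xi> \<nu> * ?a g \<nu>"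
        using h equiv by blast
      obtain \<Psi> where \<Psi>: "\<And>\<xi>. \<xi> \<in> real_characters \<Longrightarrow> \<Psi> \<xi> \<in> AP \<alpha> \<beta>"
        "\<And>\<xi> \<nu>. \<xi> \<in> real_characters \<Longrightarrow> ?a (\<Psi> \<xi>) \<nu> = \<xi> \<nu> * ?a h \<nu>"
        "\<And>\<sigma> t. \<alpha> < ereal \<sigma> \<Longrightarrow> ereal \<sigma> < \<beta> \<Longrightarrow> \<Psi> (\<lambda>\<nu>. cis (\<nu> * t)) (of_real \<sigma>) = h (Complex \<sigma> t)"
        using AP_twist[where lam = lam, OF ab D(1)[OF h(1)] D(2)[OF h(1)]] by blast
      \<comment> \<open>The value of \<open>h\<close> at height \<open>t\<close> is the value at
        height 0 of its translate, which has the coefficients of the twist of \<open>g\<close> by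
        the product character; uniqueness identifies the two functions.\<close>
      let ?\<eta> = "\<lambda>\<nu>. cis (\<nu> * t) * \<xi> \<nu>"
      have \<eta>: "?\<eta> \<in> real_characters" by (rule character_mult[OF trans \<xi>(1)])
      have "\<Psi> (\<lambda>\<nu>. cis (\<nu> * t)) (of_real \<sigma>0) = \<Phi> ?\<eta> (of_real \<sigma>0)"
        by (rule AP_eqI[OF ab \<Psi>(1)[OF trans] \<Phi>(1)[OF \<eta>] _ s])
          (simp add: \<Psi>(2)[OF trans] \<Phi>(2)[OF \<eta>] \<xi>(2))
      then have "w = \<Phi> ?\<eta> (of_real \<sigma>0)" unfolding w \<Psi>(3)[OF \<sigma>] .
      then show "w \<in> I" unfolding I_def by (rule image_eqI[OF _ \<eta>])
    qed
    moreover have "Img_F \<alpha> \<beta> lam N g \<sigma>0 = I"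
    proof -
      \<comment> \<open>\<open>x\<close> and \<open>p\<close> enter the series only through the
        numbers \<open>cis\<close> of the pairings, so any character with these values at the
        exponents gives the sum.\<close>
      have aux: "aux_F \<alpha> \<beta> lam N g \<sigma>0 x p = \<Phi> \<xi> (of_real \<sigma>0)"
        if \<xi>: "\<xi> \<in> real_characters" and eq: "\<forall>j\<in>idx N. cis (pairing lam N j (\<lambda>g. x g + p j g)) = \<xi> (lam j)"
        for x p \<xi>
      proof -
        let ?b = "\<lambda>j. ?a g (lam j) * exp (\<i> * of_real (pairing lam N j (\<lambda>g. x g + p j g)))"
        have "has_bochner_fejer_sum \<alpha> \<beta> lam N ?b (of_real \<sigma>0) w \<longleftrightarrow> w = \<Phi> \<xi> (of_real \<sigma>0)" for w
        proof (rule has_bochner_fejer_sum_iff[OF ab inj _ _ s])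
          show "\<Phi> \<xi> \<in> DirichletAP \<alpha> \<beta> (lam ` idx N)" using \<Phi>D[OF \<xi>] by (simp add: \<Lambda>)
          show "?a (\<Phi> \<xi>) (lam j) = ?b j" if "j \<in> idx N" for j
            using eq that by (simp add: \<Phi>(2)[OF \<xi>] mult.commute flip: cis_conv_exp)
        qed
        then show ?thesis unfolding aux_F_def bochner_fejer_sum_def by (intro the_equality) auto
      qed
      show ?thesis
      proof (intro equalityI subsetI)
        fix w assume "w \<in> Img_F \<alpha> \<beta> lam N g \<sigma>0"
        then obtain x p where "w = aux_F \<alpha> \<beta> lam N g \<sigma>0 x p" "coherent lam N p"
          unfolding Img_F_def by blast
        moreover from coherent_imp_character[OF this(2)] obtain \<xi> where
          "\<xi> \<in> real_characters" "\<forall>j\<in>idx N. cis (pairing lam N j (\<lambda>g. x g + p j g)) = \<xi> (lam j)" by blast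
        ultimately show "w \<in> I" using aux unfolding I_def by blast
      next
        fix w assume "w \<in> I"
        then obtain \<xi> where \<xi>: "\<xi> \<in> real_characters" "w = \<Phi> \<xi> (of_real \<sigma>0)" unfolding I_def by blast
        from character_imp_coherent[OF \<xi>(1), of lam N]
        obtain x p where xp: "x \<in> torus_box (natural_basis lam N)"
          "\<forall>j\<in>idx N. p j \<in> period_lattice (natural_basis lam N)" "coherent lam N p"
          "\<forall>j\<in>idx N. cis (pairing lam N j (\<lambda>g. x g + p j g)) = \<xi> (lam j)"
          by blast
        have "w = aux_F \<alpha> \<beta> lam N g \<sigma>0 x p" using aux[OF \<xi>(1) xp(4)] \<xi>(2) by simp
        then show "w \<in> Img_F \<alpha> \<beta> lam N g \<sigma>0"
          unfolding Img_F_def mem_Collect_eq by (intro exI[of _ x] exI[of _ p] conjI xp(1-3))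
      qed
    qed
    ultimately show ?thesis by simp
  qed
  note f = assms(3)
  have sub: "Img_line h \<sigma>0 \<subseteq> closure (Img_line g \<sigma>0)"
    if "g \<in> ?D" "h \<in> ?D" "AP_equiv \<alpha> \<beta> lam N h g" for g h
    using closures[OF that(1)] that(2,3) by blast
  have sym: "AP_equiv \<alpha> \<beta> lam N f h" if h: "h \<in> ?D" "AP_equiv \<alpha> \<beta> lam N h f" for h
  proof -
    obtain \<xi> where \<xi>: "\<xi> \<in> real_characters" "\<And>\<nu>. ?a h \<nu> = \<xi> \<nu> * ?a f \<nu>"
      using h f AP_equiv_iff_character unfolding \<Lambda> by blast
    show ?thesis by (rule character_imp_AP_equiv[OF \<xi>(1)]) (simp add: \<xi>(2) mult.commute)
  qed
  have eq: "closure (Img_line f \<sigma>0) = closure (Img_line f1 \<sigma>0)"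
    if "f1 \<in> ?D" "AP_equiv \<alpha> \<beta> lam N f1 f" for f1
    using sub[OF f that] sub[OF that(1) f sym[OF that]] by (meson closed_closure closure_minimal subset_antisym)
  have img: "closure (Img_line f \<sigma>0) =
        (\<Union>fk\<in>{fk \<in> ?D. AP_equiv \<alpha> \<beta> lam N fk f}. Img_line fk \<sigma>0)"
      "Img_F \<alpha> \<beta> lam N f \<sigma>0 = closure (Img_line f \<sigma>0)"
    using closures[OF f] by blast+
  show ?thesis
    unfolding img(2) by (intro conjI ballI impI sub[OF f] eq img(1) closed_closure)
qed

end
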